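(* Suppose that $\sup_{x\in\mathcal{X},\,t\in T}\mathrm{E}\left[l^2(c(x,\xi)-t)\right]<+\infty$ and that there exists a random variable $K(\xi)$ with $\mathrm{E}[K(\xi)^2]<\infty$ such that $$|l(c(x_1,\xi)-t_1)-l(c(x_2,\xi)-t_2)|\le K(\xi)\,\|(x_1,t_1)-(x_2,t_2)\|$$ for all $x_1,x_2\in\mathcal{X}$, $t_1,t_2\in T$ and a.e. $\xi$. Then, as $n\to\infty$, $$\sqrt{n}\,(v_n-v^* )\Rightarrow\inf_{(x,t)\in S}Y(x,t).$$ If, moreover, $S$ is a singleton $\{(x^*,t^* )\}$, then $$\sqrt{n}\,(v_n-v^* )\Rightarrow N(0,\sigma^2(x^*,t^* )).$$
   Context: Let $u$ be a proper closed concave nondecreasing utility function with $u(0)=0$ and $1\in\partial u(0)$ (subdifferential), and let $l(z)=-u(-z)$ (so $l$ is proper, closed, convex and nondecreasing). Let $\mathcal{X}$ be a compact set of decision vectors in a Euclidean space, $T\subset\mathbb{R}$ a compact interval, $\xi$ a random vector, and $c(x,\xi)$ a real-valued function. Consider the optimization of the OCE (optimized certainty equivalent) risk measure $$\min_{x\in\mathcal{X},\,t\in T}\ t+\mathrm{E}[l(c(x,\xi)-t)],$$ with optimal value $v^*$ and set of optimal solutions $S$. Let $\xi_1,\xi_2,\ldots$ be i.i.d. copies of $\xi$, and let $v_n$ be the optimal value of the sample average approximation $$\min_{x\in\mathcal{X},\,t\in T}\ \frac1n\sum_{i=1}^n\left\{t+l(c(x,\xi_i)-t)\right\}.$$ Let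 $\sigma^2(x,t)=\mathrm{Var}[l(c(x,\xi)-t)]$. $Y$ is the limit in distribution, as a random element of $C(\mathcal{X}\times T)$, of $$\sqrt{n}\left[\left(t+\frac1n\sum_{i=1}^n l(c(x,\xi_i)-t)\right)-\left(t+\mathrm{E}[l(c(x,\xi)-t)]\right)\right],$$ that is, the mean-zero Gaussian process on $\mathcal{X}\times T$ with covariance function $\mathrm{Cov}\left(l(c(x,\xi)-t),\,l(c(x',\xi)-t')\right)$. The symbol $\Rightarrow$ denotes convergence in distribution. *)

theory Defs
  imports "HOL-Probability.Probability"
begin

text \<open>
  Utility functions take values in \<open>[-\<infinity>, \<infinity>)\<close>. As usual in convex analysis, concavity and closedness
  (upper semicontinuity) are those of the hypograph, and the subdifferential of a concave
  function consists of its supergradients.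
\<close>

definition hypograph :: "(real \<Rightarrow> ereal) \<Rightarrow> (real \<times> real) set"
  where "hypograph u = {(z, r). ereal r \<le> u z}"

definition proper_closed_concave :: "(real \<Rightarrow> ereal) \<Rightarrow> bool"
  where "proper_closed_concave u \<longleftrightarrow>
    (\<forall>z. u z \<noteq> \<infinity>) \<and> (\<exists>z. u z \<noteq> -\<infinity>) \<and> convex (hypograph u) \<and> closed (hypograph u)"

definition concave_subdifferential :: "(real \<Rightarrow> ereal) \<Rightarrow> real \<Rightarrow> real set"
  where "concave_subdifferential u z = {s. \<forall>y. u y \<le> u z + ereal (s * (y - z))}"

text \<open>
  The expectation of an extended real random variable, as the difference of the integrals of
  its positive and negative parts; \<open>e2ennreal\<close> sends negative numbers to 0.
\<close>

definition ereal_expectation :: "'w measure \<Rightarrow> ('w \<Rightarrow> ereal) \<Rightarrow> ereal"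
  where "ereal_expectation M f =
    enn2ereal (\<integral>\<^sup>+ w. e2ennreal (f w) \<partial>M) - enn2ereal (\<integral>\<^sup>+ w. e2ennreal (- f w) \<partial>M)"

definition oce_objective ::
  "'w measure \<Rightarrow> (real \<Rightarrow> ereal) \<Rightarrow> ('x \<Rightarrow> 'k \<Rightarrow> real) \<Rightarrow> ('w \<Rightarrow> 'k) \<Rightarrow> 'x \<times> real \<Rightarrow> ereal"
  where "oce_objective M l c \<xi> = (\<lambda>(x, t). ereal t + ereal_expectation M (\<lambda>w. l (c x (\<xi> w) - t)))"

definition saa_objective ::
  "(real \<Rightarrow> ereal) \<Rightarrow> ('x \<Rightarrow> 'k \<Rightarrow> real) \<Rightarrow> (nat \<Rightarrow> 'w \<Rightarrow> 'k) \<Rightarrow> nat \<Rightarrow> 'w \<Rightarrow> 'x \<times> real \<Rightarrow> ereal"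
  where "saa_objective l c \<xi>s n w =
    (\<lambda>(x, t). ereal (1 / real n) * (\<Sum>i = 1..n. ereal t + l (c x (\<xi>s i w) - t)))"

definition optimal_value :: "('p \<Rightarrow> ereal) \<Rightarrow> 'p set \<Rightarrow> ereal"
  where "optimal_value f A = (INF p\<in>A. f p)"

definition optimal_solutions :: "('p \<Rightarrow> ereal) \<Rightarrow> 'p set \<Rightarrow> 'p set"
  where "optimal_solutions f A = {p \<in> A. f p = optimal_value f A}"

definition covariance :: "'w measure \<Rightarrow> ('w \<Rightarrow> real) \<Rightarrow> ('w \<Rightarrow> real) \<Rightarrow> real"
  where "covariance M X Y =
    (\<integral>w. (X w - (\<integral>w'. X w' \<partial>M)) * (Y w - (\<integral>w'. Y w' \<partial>M)) \<partial>M)"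

text \<open>The normal law with mean \<open>m\<close> and variance \<open>v\<close>, where \<open>v = 0\<close> is allowed and gives a point mass.\<close>

definition normal_law :: "real \<Rightarrow> real \<Rightarrow> real measure"
  where "normal_law m v =
    (if v = 0 then return borel m else density lborel (\<lambda>x. ennreal (normal_density m (sqrt v) x)))"

text \<open>
  A centred Gaussian random element of \<open>C(I)\<close> with covariance function \<open>k\<close>: all sample paths are
  continuous on \<open>I\<close>, and all finite linear combinations of coordinates are normal.
\<close>

definition centred_gaussian_in_C ::
  "'q measure \<Rightarrow> 'p::topological_space set \<Rightarrow> ('p \<Rightarrow> 'p \<Rightarrow> real) \<Rightarrow> ('p \<Rightarrow> 'q \<Rightarrow> real) \<Rightarrow> bool"
  where "centred_gaussian_in_C Q I k Y \<longleftrightarrow>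
    (\<forall>p\<in>I. Y p \<in> borel_measurable Q) \<and>
    (\<forall>w\<in>space Q. continuous_on I (\<lambda>p. Y p w)) \<and>
    (\<forall>F a. finite F \<and> F \<subseteq> I \<longrightarrow>
      (\<exists>m v. 0 \<le> v \<and> distr Q borel (\<lambda>w. \<Sum>p\<in>F. a p * Y p w) = normal_law m v)) \<and>
    (\<forall>p\<in>I. (\<integral>w. Y p w \<partial>Q) = 0) \<and>
    (\<forall>p\<in>I. \<forall>q\<in>I. covariance Q (Y p) (Y q) = k p q)"

text \<open>
  Convergence in distribution of \<open>Z n\<close> to the law \<open>\<mu>\<close>. Measurability is with respect to the
  completion of \<open>M\<close>: an infimum over an uncountable set that is regular only outside a null set
  need not be measurable for \<open>M\<close> itself. Measurability is required explicitly because \<open>distr\<close>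
  is not meaningful without it.
\<close>

definition converges_in_distribution ::
  "'w measure \<Rightarrow> (nat \<Rightarrow> 'w \<Rightarrow> real) \<Rightarrow> real measure \<Rightarrow> bool"
  where "converges_in_distribution M Z \<mu> \<longleftrightarrow>
    (\<forall>n. Z n \<in> borel_measurable (completion M)) \<and>
    real_distribution \<mu> \<and>
    weak_conv_m (\<lambda>n. distr (completion M) borel (Z n)) \<mu>"

end

theory Submission
  imports Defs
begin

text \<open>
  Write \<open>p = (x, t)\<close>, \<open>D = X \<times> T\<close>, \<open>f p z = l (c x z - t)\<close> and let \<open>g\<close> be the objective
  \<open>t + E[f p]\<close>, with minimum \<open>v\<close> and set of minimizers \<open>S\<close>. With the centred and scaled sums
  \<open>G n p = (\<Sum>i<n. f p (\<eta> i) - E[f p]) / sqrt n\<close>, the quantity of interest is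
  \<open>inf over p \<in> D of (G n p + sqrt n * (g p - v))\<close>. The penalty \<open>sqrt n * (g p - v)\<close> vanishes on \<open>S\<close> and
  grows without bound away from \<open>S\<close>, so that in the limit only the values of \<open>G n\<close> on \<open>S\<close>
  count, provided that \<open>G n\<close> does not oscillate too much. Three ingredients make this precise.

  The first is asymptotic equicontinuity of \<open>G n\<close>, uniformly in \<open>n\<close>, although the Lipschitz
  constant \<open>K\<close> has no more than a second moment. Where \<open>K \<le> sqrt n\<close>, an increment of \<open>G n\<close> divided by the
  distance of its two arguments has exponential moments bounded independently of \<open>n\<close>, because the
  summands are at most of order one and their variances add up to at most a constant
  (\<open>tail_iid_sum\<close>, \<open>increment_tail\<close>). Since \<open>D\<close> has polynomial covering numbers, a chaining
  argument with nets of mesh \<open>1/4 ^ k\<close> and tolerances \<open>1/2 ^ k\<close> controls the modulus of continuity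
  (\<open>modulus_of_bounded_envelope\<close>). The part of the sample with \<open>K > sqrt n\<close> contributes an
  increment whose expected size is at most a constant times the distance, by \<open>sqrt n * K \<le> K\<^sup>2\<close>
  (\<open>asymptotic_equicontinuity\<close>).

  The second is joint convergence of the values of \<open>G n\<close> at finitely many points. The central limit theorem
  and the Gaussian hypothesis on \<open>Y\<close> give convergence of the characteristic functions of all linear
  combinations. To pass to probabilities of the form \<open>P (\<forall>p\<in>F. c < G n p)\<close> it is enough to treat expectations of products
  of functions of the separate coordinates; \<open>cramer_wold_products\<close> replaces the exponentials
  by such functions one coordinate at a time, using the one-dimensional Levy theorem for
  reweighted measures.

  The third combines the two (\<open>penalized_infimum_converges\<close>). The infimum is at most the minimum of
  \<open>G n\<close> over any finite subset of \<open>S\<close>, which yields the upper bound for the probability of exceeding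
  a level. For the lower bound a finite net of \<open>S\<close> is enough: near the net \<open>G n\<close> is
  equicontinuous, and far from it the penalty dominates. Only the values of the limit process on
  \<open>S\<close> enter. When \<open>S\<close> is a single point, the limit process may therefore be taken to be the identity on
  the normal law itself, and no Gaussian process on \<open>D\<close> has to be constructed.
\<close>

section \<open>Covering numbers and chaining\<close>

text \<open>
  The second-order bound that turns a small variance into a small exponential moment.
\<close>

lemma exp_le_quadratic:
  fixes x :: real
  assumes "\<bar>x\<bar> \<le> 1"
  shows "exp x \<le> 1 + x + x\<^sup>2"
proof (cases "0 \<le> x")
  case True
  then show ?thesis using exp_bound[of x] assms by simp
next
  case False
  define y where "y = - x"
  have y: "0 < y" "y \<le> 1" using False assms by (auto simp: y_def)
  have "1 + y + y\<^sup>2 / 2 \<le> exp y"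
    using exp_lower_Taylor_quadratic[of y] y by simp
  moreover have "1 \<le> (1 + y + y\<^sup>2 / 2) * (1 - y + y\<^sup>2)"
  proof -
    have "(1 + y + y\<^sup>2 / 2) * (1 - y + y\<^sup>2) - 1 = y\<^sup>2 / 2 * (1 + y + y\<^sup>2)"
      by (simp add: power2_eq_square field_simps)
    then show ?thesis using y by (smt (verit) zero_le_mult_iff zero_le_power2 divide_nonneg_pos)
  qed
  moreover have "0 \<le> 1 - y + y\<^sup>2" using y by (smt (verit) zero_le_power2)
  ultimately have "1 \<le> exp y * (1 - y + y\<^sup>2)"
    by (smt (verit) mult_right_mono)
  then have "exp (-y) \<le> exp (-y) * (exp y * (1 - y + y\<^sup>2))"
    by simp
  also have "\<dots> = 1 - y + y\<^sup>2"
    by (simp add: mult.assoc[symmetric] exp_minus)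
  finally show ?thesis by (simp add: y_def)
qed

text \<open>
  Points are sorted into the cells of a cubic grid with mesh \<open>\<epsilon> / DIM('p)\<close>, and one point of
  \<open>D\<close> is chosen from each cell that meets \<open>D\<close>. The exponent is immaterial for chaining: any
  polynomial growth is beaten by the exponential tails of the increments.
\<close>

lemma bounded_imp_polynomial_covering:
  fixes D :: "'p::euclidean_space set"
  assumes "bounded D"
  obtains C m where "0 \<le> C"
    "\<And>\<epsilon>. 0 < \<epsilon> \<Longrightarrow> \<epsilon> \<le> 1 \<Longrightarrow>
      \<exists>N. finite N \<and> N \<subseteq> D \<and> real (card N) \<le> C * (1 / \<epsilon>) ^ m \<and> (\<forall>p\<in>D. \<exists>q\<in>N. dist p q \<le> \<epsilon>)"
proof -
  obtain R0 where R0: "\<And>p. p \<in> D \<Longrightarrow> norm p \<le> R0"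
    using assms bounded_iff by blast
  define R where "R = max R0 1"
  have R: "1 \<le> R" "\<And>p. p \<in> D \<Longrightarrow> norm p \<le> R" 
    using R0 by (force simp: R_def)+
  define d where "d = DIM('p)"
  have d: "0 < d" by (simp add: d_def)
  define C where "C = (2 * d * R + 3) ^ d"
  show ?thesis
  proof (rule that)
    show "0 \<le> C" using R by (simp add: C_def)
    fix \<epsilon> :: real assume \<epsilon>: "0 < \<epsilon>" "\<epsilon> \<le> 1"
    define key where "key p = (\<lambda>b\<in>Basis. \<lfloor>d / \<epsilon> * (p \<bullet> b)\<rfloor>)" for p :: 'p
    define L where "L = \<lceil>d / \<epsilon> * R\<rceil>"
    define rep where "rep k = (SOME p. p \<in> D \<and> key p = k)" for k
    define N where "N = rep ` key ` D"
    have "0 \<le> d / \<epsilon> * R" using R \<epsilon> by simp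
    then have L: "0 \<le> L" unfolding L_def by linarith
    have "key ` D \<subseteq> (\<Pi>\<^sub>E b\<in>Basis. {-L..L})"
    proof (clarsimp simp: key_def)
      fix p b :: 'p assume p: "p \<in> D" "b \<in> Basis"
      have "\<bar>p \<bullet> b\<bar> \<le> R" using Basis_le_norm[of b p] R p by force
      then have "d / \<epsilon> * \<bar>p \<bullet> b\<bar> \<le> d / \<epsilon> * R"
        using \<epsilon> by (intro mult_left_mono) auto
      then have "\<bar>d / \<epsilon> * (p \<bullet> b)\<bar> \<le> L"
        unfolding L_def using \<epsilon> by (simp add: abs_mult) linarith
      then have "- L \<le> \<lfloor>d / \<epsilon> * (p \<bullet> b)\<rfloor> \<and> \<lfloor>d / \<epsilon> * (p \<bullet> b)\<rfloor> \<le> L"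
        by (simp only: le_floor_iff floor_le_iff abs_le_iff of_int_minus) linarith
      then show "- L \<le> \<lfloor>d * (p \<bullet> b) / \<epsilon>\<rfloor> \<and> \<lfloor>d * (p \<bullet> b) / \<epsilon>\<rfloor> \<le> L"
        by (simp only: times_divide_eq_left)
    qed
    moreover have fin: "finite (\<Pi>\<^sub>E b\<in>(Basis::'p set). {-L..L})" by (intro finite_PiE) auto
    ultimately have "finite (key ` D)" "card (key ` D) \<le> card (\<Pi>\<^sub>E b\<in>(Basis::'p set). {-L..L})"
      by (auto intro: finite_subset card_mono)
    moreover have "card (\<Pi>\<^sub>E b\<in>(Basis::'p set). {-L..L}) = nat (2 * L + 1) ^ d"
      by (simp add: card_PiE d_def)
    ultimately have "finite N" "card N \<le> nat (2 * L + 1) ^ d"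
      unfolding N_def using card_image_le[of "key ` D" rep] by auto
    have rep: "rep (key p) \<in> D \<and> key (rep (key p)) = key p" if "p \<in> D" for p
      unfolding rep_def by (rule someI[of _ p]) (use that in auto)
    have "real (card N) \<le> real (nat (2 * L + 1)) ^ d"
      using \<open>card N \<le> _\<close> by (metis of_nat_le_iff of_nat_power)
    also have "\<dots> \<le> ((2 * d * R + 3) * (1 / \<epsilon>)) ^ d"
    proof (rule power_mono)
      have "real_of_int L \<le> d / \<epsilon> * R + 1" unfolding L_def by linarith
      then have "real (nat (2 * L + 1)) \<le> 2 * (d / \<epsilon> * R + 1) + 1" using L by simp
      also have "\<dots> \<le> (2 * d * R + 3) * (1 / \<epsilon>)"
        using \<epsilon> by (simp add: field_simps)
      finally show "real (nat (2 * L + 1)) \<le> (2 * d * R + 3) * (1 / \<epsilon>)" .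
    qed simp
    also have "\<dots> = C * (1 / \<epsilon>) ^ d" by (simp add: C_def power_mult_distrib[symmetric])
    finally have card: "real (card N) \<le> C * (1 / \<epsilon>) ^ d" .
    have close: "dist p q \<le> \<epsilon>" if "key p = key q" for p q
    proof -
      have b: "\<bar>(p - q) \<bullet> b\<bar> \<le> \<epsilon> / d" if "b \<in> Basis" for b
      proof -
        have "\<lfloor>d / \<epsilon> * (p \<bullet> b)\<rfloor> = \<lfloor>d / \<epsilon> * (q \<bullet> b)\<rfloor>"
          using fun_cong[OF \<open>key p = key q\<close>, of b] that by (simp add: key_def)
        then have "\<bar>d / \<epsilon> * (p \<bullet> b) - d / \<epsilon> * (q \<bullet> b)\<bar> \<le> 1" by linarith
        then have "d / \<epsilon> * \<bar>(p - q) \<bullet> b\<bar> \<le> 1"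
          using \<epsilon> by (simp add: inner_diff_left abs_mult right_diff_distrib[symmetric] abs_divide del: times_divide_eq_left)
        then show ?thesis using \<epsilon> d by (simp add: field_simps)
      qed
      have "norm (p - q) \<le> (\<Sum>b\<in>Basis. \<bar>(p - q) \<bullet> b\<bar>)" by (rule norm_le_l1)
      also have "\<dots> \<le> (\<Sum>b\<in>(Basis::'p set). \<epsilon> / d)" by (rule sum_mono) (rule b)
      also have "\<dots> = \<epsilon>" using d by (simp add: d_def)
      finally show ?thesis by (simp add: dist_norm)
    qed
    show "\<exists>N. finite N \<and> N \<subseteq> D \<and> real (card N) \<le> C * (1 / \<epsilon>) ^ d \<and> (\<forall>p\<in>D. \<exists>q\<in>N. dist p q \<le> \<epsilon>)"
    proof (intro exI conjI ballI)
      show "N \<subseteq> D" unfolding N_def using rep by auto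
      fix p assume "p \<in> D"
      then show "\<exists>q\<in>N. dist p q \<le> \<epsilon>"
        using rep[of p] by (intro bexI[of _ "rep (key p)"] close) (auto simp: N_def)
    qed fact+
  qed
qed

text \<open>
  Each point is reached from its neighbour in the net \<open>N k0\<close> by steps between consecutive nets, the step
  at level \<open>k\<close> costing at most \<open>(1/2) ^ k\<close>; continuity closes the chain. Two chains of total
  cost \<open>2 * (1/2) ^ k0\<close> and one step inside \<open>N k0\<close> give the constant 5. The factor 3 in
  \<open>3 * (1/4) ^ k\<close> allows for two moves to the net in addition to the distance of the two points.
\<close>

lemma chaining:
  fixes g :: "'p::metric_space \<Rightarrow> real" and N :: "nat \<Rightarrow> 'p set"
  assumes cont: "continuous_on D g"
    and N: "\<And>k. N k \<subseteq> D" "\<And>k p. p \<in> D \<Longrightarrow> \<exists>q\<in>N k. dist p q \<le> (1/4) ^ k"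
    and small: "\<And>k u v. k0 \<le> k \<Longrightarrow> u \<in> N k \<union> N (Suc k) \<Longrightarrow> v \<in> N k \<union> N (Suc k) \<Longrightarrow>
      dist u v \<le> 3 * (1/4) ^ k \<Longrightarrow> \<bar>g u - g v\<bar> \<le> (1/2) ^ k"
    and pq: "p \<in> D" "q \<in> D" "dist p q \<le> (1/4) ^ k0"
  shows "\<bar>g p - g q\<bar> \<le> 5 * (1/2) ^ k0"
proof -
  define \<pi> where "\<pi> k p = (SOME q. q \<in> N k \<and> dist p q \<le> (1/4) ^ k)" for k p
  have \<pi>: "\<pi> k p \<in> N k \<and> dist p (\<pi> k p) \<le> (1/4) ^ k" if "p \<in> D" for k p
    unfolding \<pi>_def by (rule someI_ex) (use N(2)[OF that, of k] in blast)
  have approx: "\<bar>g x - g (\<pi> k0 x)\<bar> \<le> 2 * (1/2) ^ k0" if x: "x \<in> D" for x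
  proof -
    have step: "\<bar>g (\<pi> (Suc k) x) - g (\<pi> k x)\<bar> \<le> (1/2) ^ k" if "k0 \<le> k" for k
    proof (rule small[OF that])
      have "dist (\<pi> (Suc k) x) (\<pi> k x) \<le> (1/4) ^ Suc k + (1/4) ^ k"
        using \<pi>[OF x, of k] \<pi>[OF x, of "Suc k"] dist_triangle2[of "\<pi> (Suc k) x" "\<pi> k x" x]
        by (smt (verit) dist_commute)
      moreover have "0 < (1/4::real) ^ k" by simp
      ultimately show "dist (\<pi> (Suc k) x) (\<pi> k x) \<le> 3 * (1/4) ^ k"
        unfolding power_Suc by linarith
    qed (use \<pi>[OF x] in auto)
    have tele: "\<bar>g (\<pi> (k0 + j) x) - g (\<pi> k0 x)\<bar> \<le> 2 * (1/2) ^ k0 - 2 * (1/2) ^ (k0 + j)" for j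
    proof (induction j)
      case (Suc j)
      then show ?case using step[of "k0 + j"] by simp
    qed simp
    have "(\<lambda>k. \<pi> k x) \<longlonglongrightarrow> x"
    proof (rule metric_tendsto_imp_tendsto)
      show "(\<lambda>k. (1/4::real) ^ k) \<longlonglongrightarrow> 0" by (intro LIMSEQ_realpow_zero) auto
      show "\<forall>\<^sub>F k in sequentially. dist (\<pi> k x) x \<le> dist ((1/4) ^ k) (0::real)"
        using \<pi>[OF x] by (auto simp: dist_commute)
    qed
    then have "(\<lambda>k. g (\<pi> k x)) \<longlonglongrightarrow> g x"
      using cont x \<pi>[OF x] N(1) by (intro continuous_on_tendsto_compose[OF cont]) (auto intro!: always_eventually)
    then have "(\<lambda>j. g (\<pi> (j + k0) x)) \<longlonglongrightarrow> g x" by (rule LIMSEQ_ignore_initial_segment)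
    then have "(\<lambda>j. \<bar>g (\<pi> (j + k0) x) - g (\<pi> k0 x)\<bar>) \<longlonglongrightarrow> \<bar>g x - g (\<pi> k0 x)\<bar>"
      by (intro tendsto_intros)
    then show ?thesis
    proof (rule LIMSEQ_le_const2)
      show "\<exists>M. \<forall>j\<ge>M. \<bar>g (\<pi> (j + k0) x) - g (\<pi> k0 x)\<bar> \<le> 2 * (1/2) ^ k0"
        using tele by (smt (verit) add.commute zero_le_power divide_nonneg_nonneg mult_nonneg_nonneg)
    qed
  qed
  have "dist (\<pi> k0 p) (\<pi> k0 q) \<le> dist p (\<pi> k0 p) + dist p q + dist q (\<pi> k0 q)"
    by (smt (verit) dist_triangle dist_commute)
  then have "\<bar>g (\<pi> k0 p) - g (\<pi> k0 q)\<bar> \<le> (1/2) ^ k0"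
    using \<pi>[OF pq(1), of k0] \<pi>[OF pq(2), of k0] pq(3) by (intro small) auto
  then show ?thesis using approx[OF pq(1)] approx[OF pq(2)] by linarith
qed

section \<open>Exponential tails of centred sums\<close>

text \<open>
  The common law \<open>P\<close> is a parameter, so that facts about one observation are stated for \<open>P\<close>
  and not for the underlying space.
\<close>

locale iid_sample = prob_space M for M :: "'w measure" +
  fixes P :: "'k measure" and \<eta> :: "nat \<Rightarrow> 'w \<Rightarrow> 'k"
  assumes indep: "indep_vars (\<lambda>_. P) \<eta> UNIV"
    and law: "\<And>i. distr M P (\<eta> i) = P"
begin

lemma measurable_sample [measurable]: "\<eta> i \<in> measurable M P"
  using indep by (simp add: indep_vars_def2)

sublocale P: prob_space P
  using prob_space_distr[OF measurable_sample, of 0] by (simp add: law)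

lemma
  fixes h :: "'k \<Rightarrow> 'b::{banach, second_countable_topology}"
  assumes "h \<in> borel_measurable P"
  shows integrable_sample_iff: "integrable M (\<lambda>w. h (\<eta> i w)) \<longleftrightarrow> integrable P h"
    and expectation_sample: "expectation (\<lambda>w. h (\<eta> i w)) = P.expectation h"
  using integrable_distr_eq[OF measurable_sample[of i] , of h] integral_distr[OF measurable_sample[of i], of h] assms
  by (simp_all add: law)

definition empirical_process :: "nat \<Rightarrow> ('k \<Rightarrow> real) \<Rightarrow> 'w \<Rightarrow> real"
  where "empirical_process n h w = (\<Sum>i<n. h (\<eta> i w) - P.expectation h) / sqrt (real n)"

lemma borel_measurable_empirical_process [measurable]:
  assumes [measurable]: "h \<in> borel_measurable P"
  shows "empirical_process n h \<in> borel_measurable M"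
  unfolding empirical_process_def by measurable

lemma empirical_process_add:
  assumes "integrable P g" "integrable P h"
  shows "empirical_process n (\<lambda>z. g z + h z) w = empirical_process n g w + empirical_process n h w"
  using assms by (simp add: empirical_process_def sum.distrib sum_subtractf add_divide_distrib[symmetric] algebra_simps)

lemma empirical_process_diff:
  assumes "integrable P g" "integrable P h"
  shows "empirical_process n (\<lambda>z. g z - h z) w = empirical_process n g w - empirical_process n h w"
  using assms by (simp add: empirical_process_def sum.distrib sum_subtractf diff_divide_distrib[symmetric] algebra_simps)

lemma empirical_process_cmult:
  "empirical_process n (\<lambda>z. a * h z) w = a * empirical_process n h w"
proof -
  have "(\<Sum>i<n. a * h (\<eta> i w) - P.expectation (\<lambda>z. a * h z)) = a * (\<Sum>i<n. h (\<eta> i w) - P.expectation h)"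
    unfolding sum_distrib_left by (simp add: right_diff_distrib)
  then show ?thesis by (simp add: empirical_process_def)
qed

text \<open>
  Chernoff bound with parameter 1. By independence the exponential moment of the sum is the \<open>n\<close>-th power
  of \<open>E[exp h] \<le> 1 + E[h\<^sup>2] \<le> exp (E[h\<^sup>2])\<close>.
\<close>

lemma upper_tail_iid_sum:
  assumes [measurable]: "h \<in> borel_measurable P" and bound: "\<And>z. z \<in> space P \<Longrightarrow> \<bar>h z\<bar> \<le> 1"
    and mean: "P.expectation h = 0" and var: "real n * P.expectation (\<lambda>z. (h z)\<^sup>2) \<le> V"
  shows "prob {w \<in> space M. x \<le> (\<Sum>i<n. h (\<eta> i w))} \<le> exp (V - x)"
proof -
  have bd: "exp (h z) \<le> exp 1" if "z \<in> space P" for z using bound[OF that] by auto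
  have inth: "integrable P h"
    by (rule P.integrable_const_bound[of _ 1]) (use bound in auto)
  have inth2: "integrable P (\<lambda>z. (h z)\<^sup>2)"
    by (rule P.integrable_const_bound[of _ 1])
      (use bound in \<open>auto simp: abs_square_le_1\<close>)
  have inte: "integrable P (\<lambda>z. exp (h z))"
    by (rule P.integrable_const_bound[of _ "exp 1"]) (use bd in auto)
  have int1: "integrable M (\<lambda>w. exp (h (\<eta> i w)))" for i
    using inte by (subst integrable_sample_iff) auto
  have ind: "indep_vars (\<lambda>_. borel) (\<lambda>i w. exp (h (\<eta> i w))) {..<n}"
    by (rule indep_vars_compose2[OF indep_vars_subset[OF indep]]) auto
  have eq: "exp (\<Sum>i<n. h (\<eta> i w)) = (\<Prod>i<n. exp (h (\<eta> i w)))" for w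
    by (simp add: exp_sum)
  have "expectation (\<lambda>w. exp (\<Sum>i<n. h (\<eta> i w))) = (\<Prod>i<n. expectation (\<lambda>w. exp (h (\<eta> i w))))"
    unfolding eq by (rule indep_vars_lebesgue_integral) (use ind int1 in auto)
  also have "\<dots> = P.expectation (\<lambda>z. exp (h z)) ^ n"
    by (subst expectation_sample) auto
  also have "\<dots> \<le> (exp (P.expectation (\<lambda>z. (h z)\<^sup>2))) ^ n"
  proof (rule power_mono)
    have "P.expectation (\<lambda>z. exp (h z)) \<le> P.expectation (\<lambda>z. 1 + h z + (h z)\<^sup>2)"
      by (intro integral_mono inte Bochner_Integration.integrable_add inth inth2 exp_le_quadratic bound) auto
    also have "\<dots> = 1 + P.expectation (\<lambda>z. (h z)\<^sup>2)"
      using inth inth2 by (simp add: mean P.prob_space)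
    also have "\<dots> \<le> exp (P.expectation (\<lambda>z. (h z)\<^sup>2))" by (rule exp_ge_add_one_self)
    finally show "P.expectation (\<lambda>z. exp (h z)) \<le> exp (P.expectation (\<lambda>z. (h z)\<^sup>2))" .
  qed simp
  also have "\<dots> = exp (real n * P.expectation (\<lambda>z. (h z)\<^sup>2))" by (simp add: exp_of_nat_mult)
  also have "\<dots> \<le> exp V" using var by simp
  finally have mgf: "expectation (\<lambda>w. exp (\<Sum>i<n. h (\<eta> i w))) \<le> exp V" .
  have "integrable M (\<lambda>w. exp (\<Sum>i<n. h (\<eta> i w)))"
    unfolding eq by (rule indep_vars_integrable) (use ind int1 in auto)
  then have "prob {w \<in> space M. exp x \<le> exp (\<Sum>i<n. h (\<eta> i w))} \<le> expectation (\<lambda>w. exp (\<Sum>i<n. h (\<eta> i w))) / exp x"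
    by (rule integral_Markov_inequality_measure[where A="{}"]) auto
  also have "\<dots> \<le> exp V / exp x" using mgf by (intro divide_right_mono) auto
  finally show ?thesis by (simp add: exp_diff)
qed

lemma tail_iid_sum:
  assumes [measurable]: "h \<in> borel_measurable P" and bound: "\<And>z. z \<in> space P \<Longrightarrow> \<bar>h z\<bar> \<le> 1"
    and mean: "P.expectation h = 0" and var: "real n * P.expectation (\<lambda>z. (h z)\<^sup>2) \<le> V"
  shows "prob {w \<in> space M. x < \<bar>\<Sum>i<n. h (\<eta> i w)\<bar>} \<le> 2 * exp (V - x)"
proof -
  have "prob {w \<in> space M. x < \<bar>\<Sum>i<n. h (\<eta> i w)\<bar>}
    \<le> prob ({w \<in> space M. x \<le> (\<Sum>i<n. h (\<eta> i w))} \<union> {w \<in> space M. x \<le> (\<Sum>i<n. - h (\<eta> i w))})"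
    by (rule finite_measure_mono) (auto simp: sum_negf)
  also have "\<dots> \<le> prob {w \<in> space M. x \<le> (\<Sum>i<n. h (\<eta> i w))} + prob {w \<in> space M. x \<le> (\<Sum>i<n. - h (\<eta> i w))}"
    by (rule measure_Un_le) auto
  also have "\<dots> \<le> exp (V - x) + exp (V - x)"
    by (intro add_mono upper_tail_iid_sum) (use assms in auto)
  finally show ?thesis by simp
qed

end

text \<open>
  The Lipschitz bound holds at every point of the sample space and \<open>K\<close> is nonnegative everywhere. An
  almost sure bound is brought into this form by changing \<open>f\<close> and \<open>K\<close> on a null set.
\<close>

locale lipschitz_sample = iid_sample M P \<eta>
  for M :: "'w measure" and P :: "'k measure" and \<eta> :: "nat \<Rightarrow> 'w \<Rightarrow> 'k" +
  fixes D :: "'p::euclidean_space set" and f :: "'p \<Rightarrow> 'k \<Rightarrow> real" and K :: "'k \<Rightarrow> real"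
  assumes compact_D: "compact D"
    and f_meas [measurable]: "\<And>p. p \<in> D \<Longrightarrow> f p \<in> borel_measurable P"
    and f_square: "\<And>p. p \<in> D \<Longrightarrow> integrable P (\<lambda>z. (f p z)\<^sup>2)"
    and K_meas [measurable]: "K \<in> borel_measurable P"
    and K_nonneg: "\<And>z. 0 \<le> K z"
    and K_square: "integrable P (\<lambda>z. (K z)\<^sup>2)"
    and lip: "\<And>p q z. p \<in> D \<Longrightarrow> q \<in> D \<Longrightarrow> z \<in> space P \<Longrightarrow> \<bar>f p z - f q z\<bar> \<le> K z * dist p q"
begin

abbreviation G :: "nat \<Rightarrow> 'p \<Rightarrow> 'w \<Rightarrow> real"
  where "G n p \<equiv> empirical_process n (f p)"

lemma f_integrable: "p \<in> D \<Longrightarrow> integrable P (f p)"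
  by (rule P.square_integrable_imp_integrable[OF _ f_square]) auto

lemma K_integrable: "integrable P K"
  by (rule P.square_integrable_imp_integrable[OF _ K_square]) auto

lemma G_diff: "p \<in> D \<Longrightarrow> q \<in> D \<Longrightarrow> G n p w - G n q w = empirical_process n (\<lambda>z. f p z - f q z) w"
  by (simp add: empirical_process_diff f_integrable)

lemma abs_G_diff_le:
  assumes "p \<in> D" "q \<in> D" "w \<in> space M"
  shows "\<bar>G n p w - G n q w\<bar> \<le> dist p q * ((\<Sum>i<n. K (\<eta> i w) + P.expectation K) / sqrt (real n))"
proof -
  have *: "\<bar>f p z - f q z\<bar> \<le> dist p q * K z" if "z \<in> space P" for z
    using lip[OF assms(1,2) that] by (simp add: mult.commute)
  have int: "integrable P (\<lambda>z. f p z - f q z)" using assms by (simp add: f_integrable)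
  have "\<bar>P.expectation (\<lambda>z. f p z - f q z)\<bar> \<le> P.expectation (\<lambda>z. dist p q * K z)"
    using * by (intro order_trans[OF integral_abs_bound] integral_mono)
      (auto intro: int K_integrable)
  then have m: "\<bar>P.expectation (\<lambda>z. f p z - f q z)\<bar> \<le> dist p q * P.expectation K" by simp
  have "\<bar>\<Sum>i<n. (f p (\<eta> i w) - f q (\<eta> i w)) - P.expectation (\<lambda>z. f p z - f q z)\<bar>
    \<le> (\<Sum>i<n. dist p q * (K (\<eta> i w) + P.expectation K))"
  proof (rule order_trans[OF sum_abs sum_mono])
    fix i
    have "\<eta> i w \<in> space P" using measurable_space[OF measurable_sample assms(3)] .
    from *[OF this] m show "\<bar>(f p (\<eta> i w) - f q (\<eta> i w)) - P.expectation (\<lambda>z. f p z - f q z)\<bar>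
        \<le> dist p q * (K (\<eta> i w) + P.expectation K)"
      by (simp add: distrib_left)
  qed
  then have "\<bar>empirical_process n (\<lambda>z. f p z - f q z) w\<bar>
    \<le> (\<Sum>i<n. dist p q * (K (\<eta> i w) + P.expectation K)) / sqrt (real n)"
    by (simp add: empirical_process_def abs_divide divide_right_mono)
  then show ?thesis by (simp only: G_diff[OF assms(1,2)] sum_distrib_left[symmetric] times_divide_eq_right)
qed

lemma continuous_on_G: "w \<in> space M \<Longrightarrow> continuous_on D (\<lambda>p. G n p w)"
proof -
  assume w: "w \<in> space M"
  define L where "L = (\<Sum>i<n. K (\<eta> i w) + P.expectation K) / sqrt (real n)"
  have "L-lipschitz_on D (\<lambda>p. G n p w)"
  proof (rule lipschitz_onI)
    show "0 \<le> L" unfolding L_def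
      by (intro divide_nonneg_nonneg sum_nonneg add_nonneg_nonneg K_nonneg integral_nonneg_AE) (auto simp: K_nonneg)
  qed (use abs_G_diff_le[OF _ _ w] in \<open>auto simp: dist_real_def L_def mult.commute\<close>)
  then show ?thesis by (rule lipschitz_on_continuous_on)
qed

text \<open>
  Because \<open>K \<le> sqrt n\<close>, the centred increment divided by \<open>2 * r * sqrt n\<close> is bounded by
  1, and its second moment is at most \<open>E[K\<^sup>2] / (4 * n)\<close>. The tail bound is therefore the same for
  all \<open>n\<close>.
\<close>

lemma increment_tail:
  assumes K_le: "\<And>z. K z \<le> sqrt (real n)" and n: "0 < n"
    and pq: "p \<in> D" "q \<in> D" and r: "0 < r" "dist p q \<le> r"
  shows "prob {w \<in> space M. y < \<bar>G n p w - G n q w\<bar>} \<le> 2 * exp (P.expectation (\<lambda>z. (K z)\<^sup>2) - y / (2 * r))"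
proof -
  define \<Delta> where "\<Delta> z = f p z - f q z" for z
  define m where "m = P.expectation \<Delta>"
  define s where "s = 2 * r * sqrt (real n)"
  define h where "h z = (\<Delta> z - m) / s" for z
  have [measurable]: "\<Delta> \<in> borel_measurable P" using pq unfolding \<Delta>_def by measurable
  have s: "0 < s" using r n by (simp add: s_def)
  have \<Delta>K: "\<bar>\<Delta> z\<bar> \<le> r * K z" if "z \<in> space P" for z
    using lip[OF pq that] mult_left_mono[OF r(2) K_nonneg[of z]] by (simp add: \<Delta>_def mult.commute)
  have \<Delta>n: "\<bar>\<Delta> z\<bar> \<le> r * sqrt n" if "z \<in> space P" for z
    using \<Delta>K[OF that] mult_left_mono[OF K_le[of z], of r] r by linarith
  have int: "integrable P \<Delta>" using pq unfolding \<Delta>_def by (simp add: f_integrable)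
  have \<Delta>2: "(\<Delta> z)\<^sup>2 \<le> r\<^sup>2 * (K z)\<^sup>2" if "z \<in> space P" for z
    using \<Delta>K[OF that] by (metis abs_ge_zero power2_abs power_mono power_mult_distrib)
  have int2: "integrable P (\<lambda>z. (\<Delta> z)\<^sup>2)"
    by (rule Bochner_Integration.integrable_bound[of _ "\<lambda>z. r\<^sup>2 * (K z)\<^sup>2"]) (use K_square \<Delta>2 in auto)
  have m_le: "\<bar>m\<bar> \<le> r * sqrt n"
  proof -
    have "\<bar>m\<bar> \<le> P.expectation (\<lambda>z. \<bar>\<Delta> z\<bar>)" unfolding m_def by (rule integral_abs_bound)
    also have "\<dots> \<le> P.expectation (\<lambda>z. r * sqrt n)"
      by (rule integral_mono) (use int \<Delta>n in auto)
    finally show ?thesis by (simp add: P.prob_space)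
  qed
  have "{w \<in> space M. y < \<bar>G n p w - G n q w\<bar>} = {w \<in> space M. y / (2 * r) < \<bar>\<Sum>i<n. h (\<eta> i w)\<bar>}"
  proof -
    have "G n p w - G n q w = 2 * r * (\<Sum>i<n. h (\<eta> i w))" for w
    proof -
      have "G n p w - G n q w = (\<Sum>i<n. \<Delta> (\<eta> i w) - m) / sqrt (real n)"
        by (subst G_diff[OF pq]) (simp add: empirical_process_def m_def \<Delta>_def[abs_def])
      also have "\<dots> = 2 * r * ((\<Sum>i<n. \<Delta> (\<eta> i w) - m) / s)" using r n by (simp add: s_def)
      finally show ?thesis by (simp add: h_def sum_divide_distrib)
    qed
    then show ?thesis using r by (simp add: abs_mult field_simps)
  qed
  also have "prob \<dots> \<le> 2 * exp (P.expectation (\<lambda>z. (K z)\<^sup>2) - y / (2 * r))"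
  proof (rule tail_iid_sum)
    show "h \<in> borel_measurable P" unfolding h_def by measurable
    show "\<bar>h z\<bar> \<le> 1" if "z \<in> space P" for z
      using \<Delta>n[OF that] m_le s by (simp add: h_def abs_divide s_def)
    show "P.expectation h = 0" using int by (simp add: h_def[abs_def] m_def P.prob_space)
    have "P.expectation (\<lambda>z. (h z)\<^sup>2) = P.variance \<Delta> / s\<^sup>2"
      by (simp add: h_def m_def power_divide)
    also have "\<dots> \<le> P.expectation (\<lambda>z. (\<Delta> z)\<^sup>2) / s\<^sup>2"
      using P.variance_eq[OF int int2] by (simp add: divide_right_mono)
    also have "\<dots> \<le> (r\<^sup>2 * P.expectation (\<lambda>z. (K z)\<^sup>2)) / s\<^sup>2"
    proof (rule divide_right_mono)
      have "P.expectation (\<lambda>z. (\<Delta> z)\<^sup>2) \<le> P.expectation (\<lambda>z. r\<^sup>2 * (K z)\<^sup>2)"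
        by (intro integral_mono int2 \<Delta>2) (use K_square in auto)
      then show "P.expectation (\<lambda>z. (\<Delta> z)\<^sup>2) \<le> r\<^sup>2 * P.expectation (\<lambda>z. (K z)\<^sup>2)" by simp
    qed simp
    also have "\<dots> = P.expectation (\<lambda>z. (K z)\<^sup>2) / (4 * real n)"
      using r n by (simp add: s_def power_mult_distrib)
    finally have "real n * P.expectation (\<lambda>z. (h z)\<^sup>2) \<le> P.expectation (\<lambda>z. (K z)\<^sup>2) / 4"
      using n by (simp add: field_simps)
    moreover have "0 \<le> P.expectation (\<lambda>z. (K z)\<^sup>2)" by (rule integral_nonneg_AE) simp
    ultimately show "real n * P.expectation (\<lambda>z. (h z)\<^sup>2) \<le> P.expectation (\<lambda>z. (K z)\<^sup>2)"
      by linarith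
  qed
  finally show ?thesis .
qed

end

section \<open>Asymptotic equicontinuity over a Lipschitz class\<close>

text \<open>
  The number of pairs at chaining level \<open>k\<close> grows like a power \<open>a ^ k\<close>, whereas the tail of
  one increment decays like \<open>exp (- (2 ^ k * b))\<close>.
\<close>

lemma summable_power_mult_exp_neg_power2:
  fixes a b :: real
  assumes "0 \<le> a" "0 < b"
  shows "summable (\<lambda>k. a ^ k * exp (- (2 ^ k * b)))"
proof -
  have "(\<lambda>k. a * exp (- (2 ^ k * b))) \<longlonglongrightarrow> a * 0"
  proof (intro tendsto_intros)
    have "filterlim (\<lambda>k. (2::real) ^ k * b) at_top sequentially"
    proof (rule filterlim_at_top_mono)
      show "filterlim (\<lambda>k. real k * b) at_top sequentially"
        using assms by (intro filterlim_at_top_mult_tendsto_pos[where c=b] tendsto_const filterlim_real_sequentially) auto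
      show "\<forall>\<^sub>F k in sequentially. real k * b \<le> 2 ^ k * b"
        using assms by (intro always_eventually allI mult_right_mono less_imp_le[OF of_nat_less_two_power]) auto
    qed
    then show "(\<lambda>k. exp (- (2 ^ k * b))) \<longlonglongrightarrow> 0"
      by (intro filterlim_compose[OF exp_at_bot]) (simp add: filterlim_uminus_at_top)
  qed
  then have "\<forall>\<^sub>F k in sequentially. a * exp (- (2 ^ k * b)) < 1 / 2"
    by (rule order_tendstoD) simp
  then obtain k0 where k0: "\<And>k. k0 \<le> k \<Longrightarrow> a * exp (- (2 ^ k * b)) < 1 / 2"
    by (auto simp: eventually_sequentially)
  show ?thesis
  proof (rule summable_ratio_test)
    fix k assume "k0 \<le> k"
    have "- (2 ^ Suc k * b) = - (2 ^ k * b) + - (2 ^ k * b)" by simp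
    then have "a ^ Suc k * exp (- (2 ^ Suc k * b)) = (a * exp (- (2 ^ k * b))) * (a ^ k * exp (- (2 ^ k * b)))"
      by (simp only: exp_add power_Suc) (simp add: algebra_simps)
    also have "\<dots> \<le> 1 / 2 * (a ^ k * exp (- (2 ^ k * b)))"
      using k0[OF \<open>k0 \<le> k\<close>] assms by (intro mult_right_mono) auto
    finally show "norm (a ^ Suc k * exp (- (2 ^ Suc k * b))) \<le> 1 / 2 * norm (a ^ k * exp (- (2 ^ k * b)))"
      using assms by simp
  qed simp
qed

context iid_sample
begin

lemma
  assumes [measurable]: "h \<in> borel_measurable P" and sq: "integrable P (\<lambda>z. (h z)\<^sup>2)"
    and mean: "P.expectation h = 0"
  shows integrable_iid_sum_square: "integrable M (\<lambda>w. (\<Sum>i<n. h (\<eta> i w))\<^sup>2)"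
    and expectation_iid_sum_square:
      "expectation (\<lambda>w. (\<Sum>i<n. h (\<eta> i w))\<^sup>2) = real n * P.expectation (\<lambda>z. (h z)\<^sup>2)"
proof (induction n)
  case (Suc n)
  let ?S = "\<lambda>w. \<Sum>i<n. h (\<eta> i w)"
  have inth: "integrable P h"
    by (rule P.square_integrable_imp_integrable[OF _ sq]) auto
  have int: "integrable M (\<lambda>w. h (\<eta> i w))" "integrable M (\<lambda>w. (h (\<eta> i w))\<^sup>2)"
    "expectation (\<lambda>w. h (\<eta> i w)) = 0"
    "expectation (\<lambda>w. (h (\<eta> i w))\<^sup>2) = P.expectation (\<lambda>z. (h z)\<^sup>2)" for i
    using inth sq mean expectation_sample[of h i] expectation_sample[of "\<lambda>z. (h z)\<^sup>2" i]
    by (auto simp: integrable_sample_iff integrable_sample_iff[of "\<lambda>z. (h z)\<^sup>2"])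
  have ind: "indep_var borel (\<lambda>w. h (\<eta> n w)) borel ?S"
    by (intro indep_vars_sum indep_vars_compose2[OF indep_vars_subset[OF indep]]) auto
  have cross: "integrable M (\<lambda>w. h (\<eta> n w) * ?S w)" "expectation (\<lambda>w. h (\<eta> n w) * ?S w) = 0"
    using indep_var_integrable[OF ind int(1)] indep_var_lebesgue_integral[OF ind int(1)] int(1,3) by auto
  have eq: "(\<Sum>i<Suc n. h (\<eta> i w))\<^sup>2 = (?S w)\<^sup>2 + 2 * (h (\<eta> n w) * ?S w) + (h (\<eta> n w))\<^sup>2" for w
    by (simp add: power2_sum)
  { case 1 show ?case unfolding eq using Suc.IH(1) cross int by (intro Bochner_Integration.integrable_add) auto }
  { case 2 show ?case unfolding eq using Suc.IH cross int by (simp add: algebra_simps) }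
qed auto

lemma prob_empirical_process_ge:
  assumes h[measurable]: "h \<in> borel_measurable P" and sq: "integrable P (\<lambda>z. (h z)\<^sup>2)"
    and "0 < n" "0 < a"
  shows "prob {w \<in> space M. a \<le> \<bar>empirical_process n h w\<bar>} \<le> P.variance h / a\<^sup>2"
proof -
  let ?h = "\<lambda>z. h z - P.expectation h"
  have inth: "integrable P h"
    by (rule P.square_integrable_imp_integrable[OF _ sq]) auto
  have sq': "integrable P (\<lambda>z. (?h z)\<^sup>2)" using inth sq by (simp add: power2_diff)
  have mean: "P.expectation ?h = 0" using inth by (simp add: P.prob_space)
  have eq: "(empirical_process n h w)\<^sup>2 = (\<Sum>i<n. ?h (\<eta> i w))\<^sup>2 / real n" for w
    by (simp add: empirical_process_def power_divide)
  have "{w \<in> space M. a \<le> \<bar>empirical_process n h w\<bar>} = {w \<in> space M. a\<^sup>2 \<le> (empirical_process n h w)\<^sup>2}"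
    using \<open>0 < a\<close> by (auto simp: abs_le_square_iff[symmetric])
  also have "prob \<dots> \<le> expectation (\<lambda>w. (empirical_process n h w)\<^sup>2) / a\<^sup>2"
    unfolding eq by (rule integral_Markov_inequality_measure[where A="{}"])
      (use assms integrable_iid_sum_square[OF _ sq' mean, of n] in auto)
  also have "expectation (\<lambda>w. (empirical_process n h w)\<^sup>2) = P.variance h"
    unfolding eq using expectation_iid_sum_square[OF _ sq' mean, of n] \<open>0 < n\<close> by simp
  finally show ?thesis .
qed

end

context lipschitz_sample
begin

text \<open>
  Union bound over all pairs of neighbours in the nets of levels \<open>k \<ge> k0\<close>. At level \<open>k\<close>
  the distance is at most \<open>3 * (1/4) ^ k\<close> and the tolerance is \<open>(1/2) ^ k\<close>, so the exponent
  in \<open>increment_tail\<close> is \<open>2 ^ k / 6\<close>. The exceptional event is a countable union of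
  measurable events, although the modulus of continuity concerns uncountably many points.
\<close>

lemma modulus_of_bounded_envelope:
  fixes N :: "nat \<Rightarrow> 'p set" and C V :: real and m k0 :: nat
  assumes K_le: "\<And>z. K z \<le> sqrt (real n)" and n: "0 < n"
    and N: "\<And>k. finite (N k)" "\<And>k. N k \<subseteq> D" "\<And>k. real (card (N k)) \<le> C * (4 ^ k) ^ m"
      "\<And>k. \<forall>p\<in>D. \<exists>q\<in>N k. dist p q \<le> (1/4) ^ k"
    and V: "P.expectation (\<lambda>z. (K z)\<^sup>2) \<le> V" and C: "0 \<le> C"
  defines "tail \<equiv> \<lambda>k. 2 * (C * (1 + 4 ^ m))\<^sup>2 * exp V * ((16 ^ m) ^ k * exp (- (2 ^ k * (1/6))))"
  shows "\<exists>B\<in>sets M. prob B \<le> (\<Sum>j. tail (j + k0)) \<and>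
    (\<forall>w\<in>space M - B. \<forall>p\<in>D. \<forall>q\<in>D. dist p q \<le> (1/4) ^ k0 \<longrightarrow> \<bar>G n p w - G n q w\<bar> \<le> 5 * (1/2) ^ k0)"
proof -
  define N2 where "N2 k = N k \<union> N (Suc k)" for k
  define pairs where "pairs k = {(u, v). u \<in> N2 k \<and> v \<in> N2 k \<and> dist u v \<le> 3 * (1/4) ^ k}" for k
  define bad where "bad k uv = {w \<in> space M. (1/2) ^ k < \<bar>G n (fst uv) w - G n (snd uv) w\<bar>}" for k uv
  define B where "B k = (\<Union>uv\<in>pairs k. bad k uv)" for k
  have sub: "pairs k \<subseteq> N2 k \<times> N2 k" for k by (auto simp: pairs_def)
  have finN2: "finite (N2 k)" for k using N by (simp add: N2_def)
  have fin: "finite (pairs k)" for k by (rule finite_subset[OF sub finite_cartesian_product]) (rule finN2)+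
  have pairsD: "fst uv \<in> D" "snd uv \<in> D" "dist (fst uv) (snd uv) \<le> 3 * (1/4) ^ k" if "uv \<in> pairs k" for uv k
    using that N(2)[of k] N(2)[of "Suc k"] by (auto simp: pairs_def N2_def)
  have card_pairs: "real (card (pairs k)) \<le> (C * (1 + 4 ^ m))\<^sup>2 * (16 ^ m) ^ k" for k
  proof -
    have "real (card (N2 k)) \<le> real (card (N k)) + real (card (N (Suc k)))"
      unfolding N2_def using card_Un_le[of "N k" "N (Suc k)"] by linarith
    also have "\<dots> \<le> C * (4 ^ k) ^ m + C * (4 ^ Suc k) ^ m" by (intro add_mono N)
    also have "\<dots> = C * (1 + 4 ^ m) * (4 ^ k) ^ m" by (simp add: power_mult_distrib algebra_simps)
    finally have "(real (card (N2 k)))\<^sup>2 \<le> (C * (1 + 4 ^ m) * (4 ^ k) ^ m)\<^sup>2" by (intro power_mono) auto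
    also have "\<dots> = (C * (1 + 4 ^ m))\<^sup>2 * (16 ^ m) ^ k"
    proof -
      have "(((4::real) ^ k) ^ m)\<^sup>2 = ((4\<^sup>2) ^ m) ^ k"
        by (simp only: power_mult[symmetric] ac_simps)
      then show ?thesis by (simp add: power_mult_distrib)
    qed
    finally have "(real (card (N2 k)))\<^sup>2 \<le> (C * (1 + 4 ^ m))\<^sup>2 * (16 ^ m) ^ k" .
    moreover have "card (pairs k) \<le> card (N2 k \<times> N2 k)"
      by (rule card_mono) (use sub finN2 in auto)
    then have "real (card (pairs k)) \<le> (real (card (N2 k)))\<^sup>2"
      by (simp add: card_cartesian_product power2_eq_square flip: of_nat_mult)
    ultimately show ?thesis by linarith
  qed
  have bad_meas [measurable]: "bad k uv \<in> sets M" if "uv \<in> pairs k" for k uv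
    using pairsD[OF that] unfolding bad_def by measurable
  have B_meas: "B k \<in> sets M" for k unfolding B_def using fin by auto
  have B_le: "prob (B k) \<le> tail k" for k
  proof -
    have "prob (B k) \<le> (\<Sum>uv\<in>pairs k. prob (bad k uv))"
      unfolding B_def by (rule measure_UNION_le) (use fin in auto)
    also have "\<dots> \<le> (\<Sum>uv\<in>pairs k. 2 * exp (V - 2 ^ k * (1/6)))"
    proof (rule sum_mono)
      fix uv assume uv: "uv \<in> pairs k"
      have "prob (bad k uv) \<le> 2 * exp (P.expectation (\<lambda>z. (K z)\<^sup>2) - (1/2) ^ k / (2 * (3 * (1/4) ^ k)))"
        unfolding bad_def by (rule increment_tail[OF K_le n]) (use pairsD[OF uv] in auto)
      also have "(1/2::real) ^ k / (2 * (3 * (1/4) ^ k)) = 2 ^ k * (1/6)"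
      proof -
        have "(1/2::real) ^ k / (1/4) ^ k = 2 ^ k" by (simp add: power_divide[symmetric])
        then show ?thesis by (simp add: field_simps)
      qed
      also have "2 * exp (P.expectation (\<lambda>z. (K z)\<^sup>2) - 2 ^ k * (1/6)) \<le> 2 * exp (V - 2 ^ k * (1/6))"
        using V by simp
      finally show "prob (bad k uv) \<le> 2 * exp (V - 2 ^ k * (1/6))" .
    qed
    also have "\<dots> = real (card (pairs k)) * (2 * exp (V - 2 ^ k * (1/6)))" by simp
    also have "\<dots> \<le> ((C * (1 + 4 ^ m))\<^sup>2 * (16 ^ m) ^ k) * (2 * exp (V - 2 ^ k * (1/6)))"
      by (intro mult_right_mono card_pairs) auto
    also have "\<dots> = tail k"
    proof -
      have "exp (V - 2 ^ k * (1/6)) = exp V * exp (- (2 ^ k * (1/6)))" by (simp add: exp_add[symmetric])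
      then show ?thesis unfolding tail_def by (simp only: ac_simps)
    qed
    finally show ?thesis .
  qed
  have "summable tail"
    unfolding tail_def by (intro summable_mult summable_power_mult_exp_neg_power2) auto
  then have sm: "summable (\<lambda>j. tail (j + k0))" by (rule summable_ignore_initial_segment)
  then have sm': "summable (\<lambda>j. prob (B (j + k0)))"
    by (rule summable_comparison_test_ev[rotated]) (use B_le in auto)
  have "prob (\<Union>j. B (j + k0)) \<le> (\<Sum>j. prob (B (j + k0)))"
    by (rule finite_measure_subadditive_countably) (use B_meas sm' in auto)
  also have "\<dots> \<le> (\<Sum>j. tail (j + k0))" by (rule suminf_le) (use B_le sm sm' in auto)
  finally have "prob (\<Union>j. B (j + k0)) \<le> (\<Sum>j. tail (j + k0))" .
  moreover have "\<bar>G n p w - G n q w\<bar> \<le> 5 * (1/2) ^ k0"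
    if w: "w \<in> space M - (\<Union>j. B (j + k0))" and pq: "p \<in> D" "q \<in> D" "dist p q \<le> (1/4) ^ k0" for w p q
  proof (rule chaining[OF _ N(2) _ _ pq])
    show "\<exists>q\<in>N k. dist p q \<le> (1/4) ^ k" if "p \<in> D" for k p using N(4) that by blast
    show "continuous_on D (\<lambda>p. G n p w)" using w by (intro continuous_on_G) auto
    fix k u v assume *: "k0 \<le> k" "u \<in> N k \<union> N (Suc k)" "v \<in> N k \<union> N (Suc k)" "dist u v \<le> 3 * (1/4) ^ k"
    have "w \<notin> B (k - k0 + k0)" using w by blast
    then have "w \<notin> bad k (u, v)" using * by (auto simp: B_def pairs_def N2_def)
    then show "\<bar>G n u w - G n v w\<bar> \<le> (1/2) ^ k" using w by (auto simp: bad_def)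
  qed
  ultimately show ?thesis
    by (intro bexI[of _ "\<Union>j. B (j + k0)"]) (use B_meas in auto)
qed

text \<open>
  Restricting to the event \<open>K \<le> sqrt n\<close> and to its complement yields the two Lipschitz classes into
  which the process is split.
\<close>

lemma lipschitz_sample_restrict:
  assumes [measurable]: "A \<in> sets P"
  shows "lipschitz_sample M P \<eta> D (\<lambda>p z. indicator A z * f p z) (\<lambda>z. indicator A z * K z)"
proof unfold_locales
  show "integrable P (\<lambda>z. (indicator A z * f p z)\<^sup>2)" if "p \<in> D" for p
    by (rule Bochner_Integration.integrable_bound[OF f_square[OF that]])
      (use that in \<open>auto simp: indicator_def power_mult_distrib\<close>)
  show "integrable P (\<lambda>z. (indicator A z * K z)\<^sup>2)"
    by (rule Bochner_Integration.integrable_bound[OF K_square])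
      (auto simp: indicator_def power_mult_distrib)
qed (use lip compact_D K_nonneg in \<open>auto simp: indicator_def\<close>)

text \<open>
  The part with \<open>K \<le> sqrt n\<close> is controlled by chaining. On the remaining part the increments are at
  most the distance times \<open>(\<Sum>i<n. K (\<eta> i) + E[K]) / sqrt n\<close>, with \<open>K\<close> restricted
  to \<open>K > sqrt n\<close>; its expectation is at most \<open>2 * E[K\<^sup>2]\<close>, so Markov's inequality
  bounds it by a constant \<open>c\<close> with high probability, and small \<open>\<delta>\<close> makes
  \<open>\<delta> * c\<close> small.
\<close>

theorem asymptotic_equicontinuity:
  assumes "0 < \<epsilon>" "0 < \<alpha>"
  shows "\<exists>\<delta>>0. \<forall>n>0. \<exists>B\<in>sets M. prob B \<le> \<alpha> \<and>
    (\<forall>w\<in>space M - B. \<forall>p\<in>D. \<forall>q\<in>D. dist p q \<le> \<delta> \<longrightarrow> \<bar>G n p w - G n q w\<bar> \<le> \<epsilon>)"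
proof -
  define V where "V = P.expectation (\<lambda>z. (K z)\<^sup>2)"
  have V: "0 \<le> V" unfolding V_def by (rule integral_nonneg_AE) simp
  obtain C m where C: "0 \<le> C" and cov: "\<And>\<epsilon>. 0 < \<epsilon> \<Longrightarrow> \<epsilon> \<le> 1 \<Longrightarrow>
      \<exists>N. finite N \<and> N \<subseteq> D \<and> real (card N) \<le> C * (1 / \<epsilon>) ^ m \<and> (\<forall>p\<in>D. \<exists>q\<in>N. dist p q \<le> \<epsilon>)"
    by (rule bounded_imp_polynomial_covering[OF compact_imp_bounded[OF compact_D]]) rule
  have "\<exists>N. finite N \<and> N \<subseteq> D \<and> real (card N) \<le> C * (4 ^ k) ^ m \<and> (\<forall>p\<in>D. \<exists>q\<in>N. dist p q \<le> (1/4) ^ k)" for k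
    using cov[of "(1/4) ^ k"] by (simp add: power_le_one power_one_over)
  then obtain N where N: "\<And>k. finite (N k)" "\<And>k. N k \<subseteq> D" "\<And>k. real (card (N k)) \<le> C * (4 ^ k) ^ m"
      "\<And>k. \<forall>p\<in>D. \<exists>q\<in>N k. dist p q \<le> (1/4) ^ k" by metis
  define tail where "tail = (\<lambda>k. 2 * (C * (1 + 4 ^ m))\<^sup>2 * exp V * ((16 ^ m) ^ k * exp (- (2 ^ k * (1/6)))))"
  have "summable tail"
    unfolding tail_def by (intro summable_mult summable_power_mult_exp_neg_power2) auto
  then obtain k1 where k1: "\<And>k. k1 \<le> k \<Longrightarrow> norm (\<Sum>j. tail (j + k)) < \<alpha> / 2"
    using suminf_exist_split[of "\<alpha> / 2" tail] assms by auto
  obtain k2 where k2: "(1/2::real) ^ k2 < \<epsilon> / 10" using real_arch_pow_inv[of "\<epsilon> / 10" "1/2"] assms by auto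
  define k0 where "k0 = max k1 k2"
  have "(1/2::real) ^ k0 \<le> (1/2) ^ k2" by (rule power_decreasing) (auto simp: k0_def)
  then have k0: "5 * (1/2::real) ^ k0 \<le> \<epsilon> / 2" "(\<Sum>j. tail (j + k0)) \<le> \<alpha> / 2"
    using k2 k1[of k0] by (linarith, simp add: k0_def)
  \<comment> \<open>the summand 1 keeps \<open>c\<close> positive when \<open>V = 0\<close>\<close>
  define c where "c = (4 * V + 1) / \<alpha>"
  have c: "0 < c" "2 * V / c \<le> \<alpha> / 2" using V assms by (auto simp: c_def field_simps)
  define \<delta> where "\<delta> = min ((1/4) ^ k0) (\<epsilon> / (2 * c))"
  show ?thesis
  proof (intro exI[of _ \<delta>] conjI allI impI)
    show "0 < \<delta>" using c assms by (simp add: \<delta>_def)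
    fix n :: nat assume n: "0 < n"
    define A where "A = {z \<in> space P. K z \<le> sqrt (real n)}"
    have [measurable]: "A \<in> sets P" unfolding A_def by measurable
    interpret low: lipschitz_sample M P \<eta> D "\<lambda>p z. indicator A z * f p z" "\<lambda>z. indicator A z * K z"
      by (rule lipschitz_sample_restrict) simp
    interpret high: lipschitz_sample M P \<eta> D "\<lambda>p z. indicator (space P - A) z * f p z" "\<lambda>z. indicator (space P - A) z * K z"
      by (rule lipschitz_sample_restrict) simp
    have split: "G n p w = low.G n p w + high.G n p w" if "p \<in> D" "w \<in> space M" for p w
    proof -
      have "empirical_process n (\<lambda>z. indicator A z * f p z + indicator (space P - A) z * f p z) w = low.G n p w + high.G n p w"
        by (rule empirical_process_add) (use low.f_integrable high.f_integrable that in auto)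
      moreover have "empirical_process n (\<lambda>z. indicator A z * f p z + indicator (space P - A) z * f p z) w = G n p w"
      proof -
        have "P.expectation (\<lambda>z. indicator A z * f p z + indicator (space P - A) z * f p z) = P.expectation (f p)"
          by (rule Bochner_Integration.integral_cong) (auto simp: indicator_def)
        moreover have "indicator A (\<eta> i w) * f p (\<eta> i w) + indicator (space P - A) (\<eta> i w) * f p (\<eta> i w) = f p (\<eta> i w)" for i
          using measurable_space[OF measurable_sample that(2)] by (auto simp: indicator_def)
        ultimately show ?thesis by (simp add: empirical_process_def)
      qed
      ultimately show ?thesis by simp
    qed
    have "P.expectation (\<lambda>z. (indicator A z * K z)\<^sup>2) \<le> V"
      unfolding V_def by (rule integral_mono[OF low.K_square K_square]) (auto simp: indicator_def)
    note low_V = this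
    obtain B1 where B1: "B1 \<in> sets M" "prob B1 \<le> \<alpha> / 2"
      "\<And>w p q. w \<in> space M - B1 \<Longrightarrow> p \<in> D \<Longrightarrow> q \<in> D \<Longrightarrow> dist p q \<le> (1/4) ^ k0 \<Longrightarrow>
        \<bar>low.G n p w - low.G n q w\<bar> \<le> \<epsilon> / 2"
    proof -
      have "indicator A z * K z \<le> sqrt (real n)" for z
        using n by (auto simp: A_def indicator_def)
      from low.modulus_of_bounded_envelope[OF this n N low_V C, of k0]
      obtain B where B: "B \<in> sets M" "prob B \<le> (\<Sum>j. tail (j + k0))"
        "\<forall>w\<in>space M - B. \<forall>p\<in>D. \<forall>q\<in>D. dist p q \<le> (1/4) ^ k0 \<longrightarrow>
          \<bar>low.G n p w - low.G n q w\<bar> \<le> 5 * (1/2) ^ k0"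
        by (elim bexE conjE) (rule that, simp_all only: tail_def)
      show ?thesis
      proof (rule that[OF B(1)])
        show "prob B \<le> \<alpha> / 2" using B(2) k0(2) by linarith
        show "\<bar>low.G n p w - low.G n q w\<bar> \<le> \<epsilon> / 2"
          if "w \<in> space M - B" "p \<in> D" "q \<in> D" "dist p q \<le> (1/4) ^ k0" for w p q
          using B(3)[rule_format, OF that] k0(1) by linarith
      qed
    qed
    define Kh where "Kh z = indicator (space P - A) z * K z" for z
    define R where "R w = (\<Sum>i<n. Kh (\<eta> i w) + P.expectation Kh) / sqrt (real n)" for w
    have Kh: "integrable P Kh" "Kh \<in> borel_measurable P" using high.K_integrable by (auto simp: Kh_def[abs_def])
    have Kh_nn: "0 \<le> Kh z" for z by (simp add: Kh_def K_nonneg)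
    have intKh: "integrable M (\<lambda>w. Kh (\<eta> i w))" "expectation (\<lambda>w. Kh (\<eta> i w)) = P.expectation Kh" for i
      using Kh by (auto simp: integrable_sample_iff expectation_sample)
    have "sqrt (real n) * P.expectation Kh = P.expectation (\<lambda>z. sqrt (real n) * Kh z)" by simp
    also have "\<dots> \<le> V" unfolding V_def
    proof (rule integral_mono)
      fix z assume "z \<in> space P"
      then show "sqrt (real n) * Kh z \<le> (K z)\<^sup>2"
        using K_nonneg[of z] by (auto simp: Kh_def A_def indicator_def power2_eq_square intro!: mult_right_mono)
    qed (use Kh K_square in auto)
    finally have EKh: "sqrt (real n) * P.expectation Kh \<le> V" .
    have intR: "integrable M R" unfolding R_def using intKh by auto
    have "expectation R = 2 * real n * P.expectation Kh / sqrt (real n)"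
      unfolding R_def using intKh by (simp add: prob_space Bochner_Integration.integral_sum)
    also have "\<dots> = 2 * (real n / sqrt (real n) * P.expectation Kh)" by simp
    also have "\<dots> = 2 * (sqrt (real n) * P.expectation Kh)"
      by (simp only: real_div_sqrt of_nat_0_le_iff)
    finally have ER: "expectation R \<le> 2 * V" using EKh by simp
    have Rnn: "0 \<le> R w" for w unfolding R_def
      by (intro divide_nonneg_nonneg sum_nonneg add_nonneg_nonneg Kh_nn integral_nonneg_AE) (auto simp: Kh_nn)
    define B2 where "B2 = {w \<in> space M. c \<le> R w}"
    have B2: "B2 \<in> sets M" unfolding B2_def using intR by measurable
    have "prob B2 \<le> expectation R / c"
      unfolding B2_def by (rule integral_Markov_inequality_measure[where A="{}"]) (use intR Rnn c in auto)
    also have "\<dots> \<le> 2 * V / c" using ER c by (intro divide_right_mono) auto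
    finally have PB2: "prob B2 \<le> \<alpha> / 2" using c by simp
    show "\<exists>B\<in>sets M. prob B \<le> \<alpha> \<and>
      (\<forall>w\<in>space M - B. \<forall>p\<in>D. \<forall>q\<in>D. dist p q \<le> \<delta> \<longrightarrow> \<bar>G n p w - G n q w\<bar> \<le> \<epsilon>)"
    proof (intro bexI[of _ "B1 \<union> B2"] conjI ballI impI)
      show "prob (B1 \<union> B2) \<le> \<alpha>" using measure_Un_le[OF B1(1) B2] B1 PB2 by linarith
      fix w p q assume w: "w \<in> space M - (B1 \<union> B2)" and pq: "p \<in> D" "q \<in> D" "dist p q \<le> \<delta>"
      have "\<bar>high.G n p w - high.G n q w\<bar> \<le> dist p q * R w"
        using high.abs_G_diff_le[of p q w n] w pq by (simp add: R_def Kh_def[abs_def])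
      also have "\<dots> \<le> \<delta> * c" using w pq Rnn[of w] by (intro mult_mono) (auto simp: B2_def intro: order_trans[OF zero_le_dist])
      also have "\<dots> \<le> \<epsilon> / (2 * c) * c" using c by (intro mult_right_mono) (auto simp: \<delta>_def)
      also have "\<dots> = \<epsilon> / 2" using c by simp
      finally have "\<bar>high.G n p w - high.G n q w\<bar> \<le> \<epsilon> / 2" .
      moreover have "\<bar>low.G n p w - low.G n q w\<bar> \<le> \<epsilon> / 2"
        by (rule B1(3)) (use w pq in \<open>auto simp: \<delta>_def\<close>)
      moreover have "G n p w = low.G n p w + high.G n p w" "G n q w = low.G n q w + high.G n q w"
        using split pq w by auto
      ultimately show "\<bar>G n p w - G n q w\<bar> \<le> \<epsilon>" by linarith
    qed (use B1 B2 in auto)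
  qed
qed

text \<open>
  Equicontinuity reduces the supremum over \<open>D\<close> to a finite net, where the variance bound applies.
\<close>

theorem empirical_process_bounded_in_probability:
  assumes "0 < \<alpha>"
  shows "\<exists>C. \<forall>n>0. \<exists>B\<in>sets M. prob B \<le> \<alpha> \<and> (\<forall>w\<in>space M - B. \<forall>p\<in>D. \<bar>G n p w\<bar> \<le> C)"
proof -
  obtain \<delta> where \<delta>: "0 < \<delta>" "\<And>n. 0 < n \<Longrightarrow> \<exists>B\<in>sets M. prob B \<le> \<alpha> / 2 \<and>
    (\<forall>w\<in>space M - B. \<forall>p\<in>D. \<forall>q\<in>D. dist p q \<le> \<delta> \<longrightarrow> \<bar>G n p w - G n q w\<bar> \<le> 1)"
    using asymptotic_equicontinuity[of 1 "\<alpha> / 2"] assms by auto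
  obtain F where F: "finite F" "F \<subseteq> D" "D \<subseteq> (\<Union>p\<in>F. ball p \<delta>)"
    using seq_compact_imp_totally_bounded[OF compact_imp_seq_compact[OF compact_D], rule_format, OF \<delta>(1)]
    by (elim exE conjE) rule
  define W where "W = (\<Sum>p\<in>F. P.variance (f p))"
  have var_nn: "0 \<le> P.variance (f p)" for p by (rule integral_nonneg_AE) simp
  then have W: "0 \<le> W" unfolding W_def by (intro sum_nonneg) 
  \<comment> \<open>chosen such that \<open>W / a\<^sup>2 \<le> \<alpha> / 2\<close> and \<open>a > 0\<close>\<close>
  define a where "a = sqrt (2 * W / \<alpha> + 1)"
  have a: "0 < a" "a\<^sup>2 = 2 * W / \<alpha> + 1" using W assms by (auto simp: a_def intro: add_nonneg_pos)
  have aW: "W / a\<^sup>2 \<le> \<alpha> / 2" using a W assms by (auto simp: field_simps) 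
  show ?thesis
  proof (intro exI[of _ "a + 1"] allI impI)
    fix n :: nat assume n: "0 < n"
    obtain B1 where B1: "B1 \<in> sets M" "prob B1 \<le> \<alpha> / 2"
      "\<And>w p q. w \<in> space M - B1 \<Longrightarrow> p \<in> D \<Longrightarrow> q \<in> D \<Longrightarrow> dist p q \<le> \<delta> \<Longrightarrow> \<bar>G n p w - G n q w\<bar> \<le> 1"
      using \<delta>(2)[OF n] by blast
    define B2 where "B2 = (\<Union>p\<in>F. {w \<in> space M. a \<le> \<bar>G n p w\<bar>})"
    have meas: "{w \<in> space M. a \<le> \<bar>G n p w\<bar>} \<in> sets M" if "p \<in> F" for p
      using that F(2) f_meas[of p] by (auto intro!: borel_measurable_le borel_measurable_abs)
    then have B2: "B2 \<in> sets M" unfolding B2_def using F(1) by auto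
    have "prob B2 \<le> (\<Sum>p\<in>F. prob {w \<in> space M. a \<le> \<bar>G n p w\<bar>})"
      unfolding B2_def by (rule measure_UNION_le[OF F(1) meas])
    also have "\<dots> \<le> (\<Sum>p\<in>F. P.variance (f p) / a\<^sup>2)"
      by (intro sum_mono prob_empirical_process_ge) (use F(2) f_square n a(1) in auto)
    also have "\<dots> = W / a\<^sup>2" by (simp add: W_def sum_divide_distrib)
    finally have PB2: "prob B2 \<le> \<alpha> / 2" using aW by linarith
    show "\<exists>B\<in>sets M. prob B \<le> \<alpha> \<and> (\<forall>w\<in>space M - B. \<forall>p\<in>D. \<bar>G n p w\<bar> \<le> a + 1)"
    proof (intro bexI[of _ "B1 \<union> B2"] conjI ballI impI)
      show "prob (B1 \<union> B2) \<le> \<alpha>" using measure_Un_le[OF B1(1) B2] B1 PB2 by linarith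
      fix w p assume w: "w \<in> space M - (B1 \<union> B2)" and p: "p \<in> D"
      then obtain q where q: "q \<in> F" "dist p q \<le> \<delta>" using F(3) by (force simp: dist_commute)
      have "\<bar>G n p w - G n q w\<bar> \<le> 1" using w p q F(2) by (intro B1(3)) auto
      moreover have "\<bar>G n q w\<bar> < a" using w q by (auto simp: B2_def)
      ultimately show "\<bar>G n p w\<bar> \<le> a + 1" by linarith
    qed (use B1 B2 in auto)
  qed
qed

end

section \<open>Joint convergence from linear combinations\<close>

lemma (in prob_space) integrable_bounded:
  fixes g :: "'a \<Rightarrow> 'b::{banach, second_countable_topology}"
  assumes "g \<in> borel_measurable M" "\<And>w. w \<in> space M \<Longrightarrow> norm (g w) \<le> C"
  shows "integrable M g"
  using assms by (intro integrable_const_bound[of _ C]) auto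

text \<open>
  Adding 2 to a weight \<open>R\<close> with values in \<open>[-1, 1]\<close> makes it a positive function whose
  integral \<open>c\<close> is at least 1. Normalizing it to a probability density can thus never degenerate, not even
  in the limit.
\<close>

lemma (in prob_space)
  fixes R U :: "'a \<Rightarrow> real"
  assumes [measurable]: "R \<in> borel_measurable M" "U \<in> borel_measurable M"
    and R: "\<And>w. \<bar>R w\<bar> \<le> 1"
  defines "c \<equiv> expectation (\<lambda>w. 2 + R w)"
  defines "\<nu> \<equiv> distr (density M (\<lambda>w. ennreal ((2 + R w) / c))) borel U"
  shows tilted_mass: "1 \<le> c"
    and real_distribution_tilted: "real_distribution \<nu>"
    and integral_tilted: "\<And>g :: real \<Rightarrow> 'b::{banach, second_countable_topology}. g \<in> borel_measurable borel \<Longrightarrow>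
      (\<And>x. norm (g x) \<le> 1) \<Longrightarrow>
      integral\<^sup>L \<nu> g = (2 *\<^sub>R expectation (\<lambda>w. g (U w)) + expectation (\<lambda>w. R w *\<^sub>R g (U w))) /\<^sub>R c"
proof -
  have R': "- 1 \<le> R w" "R w \<le> 1" for w using R[of w] by auto
  have intR: "integrable M R" by (rule integrable_bounded[of _ 1]) (use R in auto)
  have "1 \<le> 2 + R w" for w using R'(1)[of w] by linarith
  then have "expectation (\<lambda>w. 1) \<le> c" unfolding c_def
    by (intro integral_mono) (use intR in auto)
  then show c: "1 \<le> c" by (simp add: prob_space)
  have pos: "0 \<le> (2 + R w) / c" for w using R'[of w] c by (intro divide_nonneg_nonneg) auto
  have "emeasure (density M (\<lambda>w. ennreal ((2 + R w) / c))) (space M) = (\<integral>\<^sup>+w. ennreal ((2 + R w) / c) \<partial>M)"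
    by (subst emeasure_density) (auto intro!: nn_integral_cong)
  also have "\<dots> = ennreal (expectation (\<lambda>w. (2 + R w) / c))"
    by (rule nn_integral_eq_integral) (use intR pos in auto)
  also have "\<dots> = 1" using c by (simp add: c_def)
  finally interpret d: prob_space "density M (\<lambda>w. ennreal ((2 + R w) / c))"
    by (intro prob_spaceI) simp
  show "real_distribution \<nu>" unfolding \<nu>_def by (rule d.real_distribution_distr) simp
  fix g :: "real \<Rightarrow> 'b" assume [measurable]: "g \<in> borel_measurable borel" and g: "\<And>x. norm (g x) \<le> 1"
  have int1: "integrable M (\<lambda>w. g (U w))" by (rule integrable_bounded[of _ 1]) (use g in auto)
  have int2: "integrable M (\<lambda>w. R w *\<^sub>R g (U w))"
    by (rule integrable_bounded[of _ 1]) (use R g in \<open>auto intro!: mult_le_one\<close>)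
  have "integral\<^sup>L \<nu> g = expectation (\<lambda>w. ((2 + R w) / c) *\<^sub>R g (U w))"
    unfolding \<nu>_def using pos by (simp add: integral_distr integral_density)
  also have "\<dots> = expectation (\<lambda>w. (2 *\<^sub>R g (U w) + R w *\<^sub>R g (U w)) /\<^sub>R c)"
    by (simp add: scaleR_add_left[symmetric] divide_inverse mult.commute)
  also have "\<dots> = (2 *\<^sub>R expectation (\<lambda>w. g (U w)) + expectation (\<lambda>w. R w *\<^sub>R g (U w))) /\<^sub>R c"
    using int1 int2 by simp
  finally show "integral\<^sup>L \<nu> g = (2 *\<^sub>R expectation (\<lambda>w. g (U w)) + expectation (\<lambda>w. R w *\<^sub>R g (U w))) /\<^sub>R c" .
qed

text \<open>
  The characteristic functions of the reweighted laws converge, so the Levy theorem applies to them; the contribution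
  of the constant 2 in the density is removed by the Levy theorem without weights.
\<close>

lemma levy_continuity_real_weights:
  fixes U R :: "nat \<Rightarrow> 'w \<Rightarrow> real" and U' R' :: "'q \<Rightarrow> real" and h :: "real \<Rightarrow> real"
  assumes "prob_space M" "prob_space Q"
    and meas [measurable]: "\<And>n. U n \<in> borel_measurable M" "\<And>n. R n \<in> borel_measurable M"
      "U' \<in> borel_measurable Q" "R' \<in> borel_measurable Q"
    and R: "\<And>n w. \<bar>R n w\<bar> \<le> 1" "\<And>w. \<bar>R' w\<bar> \<le> 1"
    and unweighted: "\<And>s. (\<lambda>n. \<integral>w. iexp (s * U n w) \<partial>M) \<longlonglongrightarrow> (\<integral>w. iexp (s * U' w) \<partial>Q)"
    and weighted: "\<And>s. (\<lambda>n. \<integral>w. R n w *\<^sub>R iexp (s * U n w) \<partial>M) \<longlonglongrightarrow> (\<integral>w. R' w *\<^sub>R iexp (s * U' w) \<partial>Q)"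
    and h: "\<And>x. isCont h x" "\<And>x. \<bar>h x\<bar> \<le> 1"
  shows "(\<lambda>n. \<integral>w. R n w * h (U n w) \<partial>M) \<longlonglongrightarrow> (\<integral>w. R' w * h (U' w) \<partial>Q)"
proof -
  interpret M: prob_space M by fact
  interpret Q: prob_space Q by fact
  define c where "c n = M.expectation (\<lambda>w. 2 + R n w)" for n
  define c' where "c' = Q.expectation (\<lambda>w. 2 + R' w)"
  define \<nu> where "\<nu> n = distr (density M (\<lambda>w. ennreal ((2 + R n w) / c n))) borel (U n)" for n
  define \<nu>' where "\<nu>' = distr (density Q (\<lambda>w. ennreal ((2 + R' w) / c'))) borel U'"
  note defs = \<nu>_def c_def \<nu>'_def c'_def
  have [measurable]: "h \<in> borel_measurable borel"
    using h(1) by (intro borel_measurable_continuous_onI continuous_at_imp_continuous_on) auto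
  have real: "real_distribution (\<nu> n)" "real_distribution \<nu>'" for n
    unfolding defs using R by (auto intro!: M.real_distribution_tilted Q.real_distribution_tilted)
  have cpos: "1 \<le> c n" "1 \<le> c'" for n
    unfolding defs using R M.tilted_mass[of "R n" "U n"] Q.tilted_mass[of R' U'] by auto
  have intR: "integrable M (R n)" "integrable Q R'" for n
    using R by (auto intro!: M.integrable_bounded[of _ 1] Q.integrable_bounded[of _ 1])
  have "(\<lambda>n. complex_of_real (2 + M.expectation (R n))) \<longlonglongrightarrow> complex_of_real (2 + Q.expectation R')"
    using tendsto_add[OF tendsto_const[of "2::complex"] weighted[of 0]] intR by (simp add: scaleR_conv_of_real)
  then have "(\<lambda>n. 2 + M.expectation (R n)) \<longlonglongrightarrow> 2 + Q.expectation R'"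
    by (rule tendsto_of_real_iff[THEN iffD1])
  then have c_lim: "c \<longlonglongrightarrow> c'"
    using intR unfolding c_def[abs_def] c'_def by (simp add: M.prob_space Q.prob_space)
  have "weak_conv_m \<nu> \<nu>'"
  proof (rule levy_continuity)
    fix s
    have 1: "char (\<nu> n) s = (2 *\<^sub>R M.expectation (\<lambda>w. iexp (s * U n w)) + M.expectation (\<lambda>w. R n w *\<^sub>R iexp (s * U n w))) /\<^sub>R c n" for n
      unfolding char_def defs by (rule M.integral_tilted) (use R in auto)
    have 2: "char \<nu>' s = (2 *\<^sub>R Q.expectation (\<lambda>w. iexp (s * U' w)) + Q.expectation (\<lambda>w. R' w *\<^sub>R iexp (s * U' w))) /\<^sub>R c'"
      unfolding char_def defs by (rule Q.integral_tilted) (use R in auto)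
    show "(\<lambda>n. char (\<nu> n) s) \<longlonglongrightarrow> char \<nu>' s"
      unfolding 1 2 by (intro tendsto_intros c_lim unweighted weighted) (use cpos in auto)
  qed (rule real)+
  from weak_conv_imp_integral_bdd_continuous_conv[OF real this, where f=h and B=1] h
  have "(\<lambda>n. integral\<^sup>L (\<nu> n) h) \<longlonglongrightarrow> integral\<^sup>L \<nu>' h" by auto
  moreover have "integral\<^sup>L (\<nu> n) h = (2 *\<^sub>R M.expectation (\<lambda>w. h (U n w)) + M.expectation (\<lambda>w. R n w *\<^sub>R h (U n w))) /\<^sub>R c n" for n
    unfolding defs by (rule M.integral_tilted) (use R h in auto)
  moreover have "integral\<^sup>L \<nu>' h = (2 *\<^sub>R Q.expectation (\<lambda>w. h (U' w)) + Q.expectation (\<lambda>w. R' w *\<^sub>R h (U' w))) /\<^sub>R c'"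
    unfolding defs by (rule Q.integral_tilted) (use R h in auto)
  ultimately have "(\<lambda>n. c n * ((2 * M.expectation (\<lambda>w. h (U n w)) + M.expectation (\<lambda>w. R n w * h (U n w))) / c n))
    \<longlonglongrightarrow> c' * ((2 * Q.expectation (\<lambda>w. h (U' w)) + Q.expectation (\<lambda>w. R' w * h (U' w))) / c')"
    by (intro tendsto_mult c_lim) (simp add: divide_inverse mult.commute)
  moreover have "c n \<noteq> 0" "c' \<noteq> 0" for n using cpos(1)[of n] cpos(2) by auto
  ultimately have tilted: "(\<lambda>n. 2 * M.expectation (\<lambda>w. h (U n w)) + M.expectation (\<lambda>w. R n w * h (U n w)))
    \<longlonglongrightarrow> 2 * Q.expectation (\<lambda>w. h (U' w)) + Q.expectation (\<lambda>w. R' w * h (U' w))"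
    by simp
  have "weak_conv_m (\<lambda>n. distr M borel (U n)) (distr Q borel U')"
    by (rule levy_continuity) (use unweighted in \<open>auto simp: char_def integral_distr intro!: M.real_distribution_distr Q.real_distribution_distr\<close>)
  from weak_conv_imp_integral_bdd_continuous_conv[OF _ _ this, where f=h and B=1] h
  have "(\<lambda>n. integral\<^sup>L (distr M borel (U n)) h) \<longlonglongrightarrow> integral\<^sup>L (distr Q borel U') h"
    by (auto intro!: M.real_distribution_distr Q.real_distribution_distr)
  then have "(\<lambda>n. M.expectation (\<lambda>w. h (U n w))) \<longlonglongrightarrow> Q.expectation (\<lambda>w. h (U' w))"
    by (simp add: integral_distr)
  from tendsto_diff[OF tilted tendsto_mult[OF tendsto_const[of 2] this]] show ?thesis by simp
qed

text \<open>
  Real and imaginary parts of a complex weight are combinations of the weight and its conjugate, and convergence for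
  the conjugate follows by conjugating at \<open>- s\<close>.
\<close>

lemma levy_continuity_weighted:
  fixes U :: "nat \<Rightarrow> 'w \<Rightarrow> real" and U' :: "'q \<Rightarrow> real" and W :: "nat \<Rightarrow> 'w \<Rightarrow> complex" and W' :: "'q \<Rightarrow> complex"
    and h :: "real \<Rightarrow> real"
  assumes "prob_space M" "prob_space Q"
    and meas [measurable]: "\<And>n. U n \<in> borel_measurable M" "\<And>n. W n \<in> borel_measurable M"
      "U' \<in> borel_measurable Q" "W' \<in> borel_measurable Q"
    and W: "\<And>n w. norm (W n w) \<le> 1" "\<And>w. norm (W' w) \<le> 1"
    and unweighted: "\<And>s. (\<lambda>n. \<integral>w. iexp (s * U n w) \<partial>M) \<longlonglongrightarrow> (\<integral>w. iexp (s * U' w) \<partial>Q)"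
    and weighted: "\<And>s. (\<lambda>n. \<integral>w. W n w * iexp (s * U n w) \<partial>M) \<longlonglongrightarrow> (\<integral>w. W' w * iexp (s * U' w) \<partial>Q)"
    and h: "\<And>x. isCont h x" "\<And>x. \<bar>h x\<bar> \<le> 1"
  shows "(\<lambda>n. \<integral>w. W n w * of_real (h (U n w)) \<partial>M) \<longlonglongrightarrow> (\<integral>w. W' w * of_real (h (U' w)) \<partial>Q)"
proof -
  interpret M: prob_space M by fact
  interpret Q: prob_space Q by fact
  have [measurable]: "h \<in> borel_measurable borel"
    using h(1) by (intro borel_measurable_continuous_onI continuous_at_imp_continuous_on) auto
  have [measurable]: "cnj \<in> borel_measurable borel"
    by (intro borel_measurable_continuous_onI continuous_intros)
  have cnj_weighted: "(\<lambda>n. \<integral>w. cnj (W n w) * iexp (s * U n w) \<partial>M) \<longlonglongrightarrow> (\<integral>w. cnj (W' w) * iexp (s * U' w) \<partial>Q)" for s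
  proof -
    have "cnj (z * iexp (- s * u)) = cnj z * iexp (s * u)" for z u
      by (simp add: exp_cnj)
    then have "cnj (\<integral>w. W n w * iexp (- s * U n w) \<partial>M) = (\<integral>w. cnj (W n w) * iexp (s * U n w) \<partial>M)"
      "cnj (\<integral>w. W' w * iexp (- s * U' w) \<partial>Q) = (\<integral>w. cnj (W' w) * iexp (s * U' w) \<partial>Q)" for n
      using Bochner_Integration.integral_cnj[of M "\<lambda>w. W n w * iexp (- s * U n w)"] Bochner_Integration.integral_cnj[of Q "\<lambda>w. W' w * iexp (- s * U' w)"]
      by (simp_all only:)
    then show ?thesis using tendsto_cnj[OF weighted[of "- s"]] by simp
  qed
  have int: "integrable M (\<lambda>w. W n w * iexp (s * U n w))" "integrable M (\<lambda>w. cnj (W n w) * iexp (s * U n w))"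
    "integrable Q (\<lambda>w. W' w * iexp (s * U' w))" "integrable Q (\<lambda>w. cnj (W' w) * iexp (s * U' w))" for n s
    using W by (auto intro!: M.integrable_bounded[of _ 1] Q.integrable_bounded[of _ 1] simp: norm_mult)
  have ReIm: "Re z *\<^sub>R e = (z * e + cnj z * e) / 2" "Im z *\<^sub>R e = (z * e - cnj z * e) / (2 * \<i>)" for z e :: complex
    by (simp_all add: complex_eq_iff scaleR_conv_of_real complex_add_cnj complex_diff_cnj flip: distrib_right left_diff_distrib)
  have Re: "(\<lambda>n. \<integral>w. Re (W n w) * h (U n w) \<partial>M) \<longlonglongrightarrow> (\<integral>w. Re (W' w) * h (U' w) \<partial>Q)"
  proof (rule levy_continuity_real_weights[OF assms(1,2), where U=U and U'=U' and R="\<lambda>n w. Re (W n w)" and R'="\<lambda>w. Re (W' w)"])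
    show "\<bar>Re (W n w)\<bar> \<le> 1" "\<bar>Re (W' w')\<bar> \<le> 1" for n w w'
      using W abs_Re_le_cmod order_trans by blast+
    show "(\<lambda>n. \<integral>w. Re (W n w) *\<^sub>R iexp (s * U n w) \<partial>M) \<longlonglongrightarrow> (\<integral>w. Re (W' w) *\<^sub>R iexp (s * U' w) \<partial>Q)" for s
      unfolding ReIm using tendsto_add[OF weighted[of s] cnj_weighted[of s]] int(1,2)[of _ s] int(3,4)[of s]
      by (simp add: tendsto_divide)
  qed (use unweighted h in auto)
  have Im: "(\<lambda>n. \<integral>w. Im (W n w) * h (U n w) \<partial>M) \<longlonglongrightarrow> (\<integral>w. Im (W' w) * h (U' w) \<partial>Q)"
  proof (rule levy_continuity_real_weights[OF assms(1,2), where U=U and U'=U' and R="\<lambda>n w. Im (W n w)" and R'="\<lambda>w. Im (W' w)"])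
    show "\<bar>Im (W n w)\<bar> \<le> 1" "\<bar>Im (W' w')\<bar> \<le> 1" for n w w'
      using W abs_Im_le_cmod order_trans by blast+
    show "(\<lambda>n. \<integral>w. Im (W n w) *\<^sub>R iexp (s * U n w) \<partial>M) \<longlonglongrightarrow> (\<integral>w. Im (W' w) *\<^sub>R iexp (s * U' w) \<partial>Q)" for s
      unfolding ReIm using tendsto_diff[OF weighted[of s] cnj_weighted[of s]] int(1,2)[of _ s] int(3,4)[of s]
      by (auto intro!: tendsto_intros)
  qed (use unweighted h in auto)
  have intW: "integrable M (\<lambda>w. W n w * of_real (h (U n w)))" "integrable Q (\<lambda>w. W' w * of_real (h (U' w)))" for n
    using W h by (auto intro!: M.integrable_bounded[of _ 1] Q.integrable_bounded[of _ 1] mult_le_one simp: norm_mult)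
  have "(\<integral>w. W n w * of_real (h (U n w)) \<partial>M) = Complex (\<integral>w. Re (W n w) * h (U n w) \<partial>M) (\<integral>w. Im (W n w) * h (U n w) \<partial>M)"
    "(\<integral>w. W' w * of_real (h (U' w)) \<partial>Q) = Complex (\<integral>w. Re (W' w) * h (U' w) \<partial>Q) (\<integral>w. Im (W' w) * h (U' w) \<partial>Q)" for n
    using intW(1)[of n] intW(2) by (simp_all add: complex_eq_iff flip: integral_Re integral_Im)
  then show ?thesis using tendsto_Complex[OF Re Im] by simp
qed

text \<open>
  Induction on the set \<open>A\<close> of coordinates in which the exponential has already been supplemented by the
  factor \<open>h\<close>. The product obtained so far is a bounded complex weight for the next coordinate, and
  multiplying it by \<open>exp (i s V q)\<close> only changes the coefficient of the coordinate \<open>q\<close> in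
  the linear combination.
\<close>

lemma cramer_wold_products:
  fixes V :: "nat \<Rightarrow> 'p \<Rightarrow> 'w \<Rightarrow> real" and V' :: "'p \<Rightarrow> 'q \<Rightarrow> real" and h :: "real \<Rightarrow> real"
  assumes prob: "prob_space M" "prob_space Q" and F: "finite F"
    and meas [measurable]: "\<And>n p. p \<in> F \<Longrightarrow> V n p \<in> borel_measurable M"
      "\<And>p. p \<in> F \<Longrightarrow> V' p \<in> borel_measurable Q"
    and conv: "\<And>a. (\<lambda>n. \<integral>w. iexp (\<Sum>p\<in>F. a p * V n p w) \<partial>M) \<longlonglongrightarrow> (\<integral>w. iexp (\<Sum>p\<in>F. a p * V' p w) \<partial>Q)"
    and h: "\<And>x. isCont h x" "\<And>x. \<bar>h x\<bar> \<le> 1"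
  shows "(\<lambda>n. \<integral>w. (\<Prod>p\<in>F. h (V n p w)) \<partial>M) \<longlonglongrightarrow> (\<integral>w. (\<Prod>p\<in>F. h (V' p w)) \<partial>Q)"
proof -
  interpret M: prob_space M by fact
  interpret Q: prob_space Q by fact
  have [measurable]: "h \<in> borel_measurable borel"
    using h(1) by (intro borel_measurable_continuous_onI continuous_at_imp_continuous_on) auto
  have sum_upd: "(\<Sum>p\<in>F. (a(q := a q + s)) p * x p) = (\<Sum>p\<in>F. a p * x p) + s * x q"
    if "q \<in> F" for a x :: "'p \<Rightarrow> real" and q s
  proof -
    have "(\<Sum>p\<in>F. (a(q := a q + s)) p * x p) = (\<Sum>p\<in>F. a p * x p + (if p = q then s * x p else 0))"
      by (rule sum.cong) (auto simp: algebra_simps)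
    then show ?thesis using F that by (simp add: sum.distrib)
  qed
  have prod_le: "norm (\<Prod>p\<in>A. complex_of_real (h (x p))) \<le> 1" for A and x :: "'p \<Rightarrow> real"
    unfolding prod_norm[symmetric] using h(2) by (intro prod_le_1) auto
  have "(\<lambda>n. \<integral>w. iexp (\<Sum>p\<in>F. a p * V n p w) * (\<Prod>p\<in>A. of_real (h (V n p w))) \<partial>M)
    \<longlonglongrightarrow> (\<integral>w. iexp (\<Sum>p\<in>F. a p * V' p w) * (\<Prod>p\<in>A. of_real (h (V' p w))) \<partial>Q)"
    if "finite A" "A \<subseteq> F" for A a
    using that
  proof (induction A arbitrary: a rule: finite_induct)
    case empty
    then show ?case using conv by simp
  next
    case (insert q A)
    then have q: "q \<in> F" and A: "\<And>p. p \<in> A \<Longrightarrow> p \<in> F" by auto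
    let ?W = "\<lambda>n w. iexp (\<Sum>p\<in>F. a p * V n p w) * (\<Prod>p\<in>A. of_real (h (V n p w)))"
    let ?W' = "\<lambda>w. iexp (\<Sum>p\<in>F. a p * V' p w) * (\<Prod>p\<in>A. of_real (h (V' p w)))"
    have "(\<lambda>n. \<integral>w. ?W n w * of_real (h (V n q w)) \<partial>M) \<longlonglongrightarrow> (\<integral>w. ?W' w * of_real (h (V' q w)) \<partial>Q)"
    proof (rule levy_continuity_weighted[OF prob, where U="\<lambda>n. V n q" and U'="V' q" and W="?W" and W'="?W'"])
      show "V n q \<in> borel_measurable M" "V' q \<in> borel_measurable Q" for n using q by auto
      show "?W n \<in> borel_measurable M" for n
        using A by (intro borel_measurable_times borel_measurable_prod) measurable
      show "?W' \<in> borel_measurable Q"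
        using A by (intro borel_measurable_times borel_measurable_prod) measurable
      show "norm (?W n w) \<le> 1" "norm (?W' w') \<le> 1" for n w w'
        using prod_le by (simp_all add: norm_mult)
      fix s
      show "(\<lambda>n. \<integral>w. iexp (s * V n q w) \<partial>M) \<longlonglongrightarrow> (\<integral>w. iexp (s * V' q w) \<partial>Q)"
        using conv[of "(\<lambda>_. 0)(q := 0 + s)"] unfolding sum_upd[OF q, of "\<lambda>_. 0"] by simp
      have eq: "iexp (\<Sum>p\<in>F. (a(q := a q + s)) p * x p) * z = iexp (\<Sum>p\<in>F. a p * x p) * z * iexp (s * x q)"
        for x :: "'p \<Rightarrow> real" and z
        unfolding sum_upd[OF q] by (simp add: distrib_left exp_add)
      show "(\<lambda>n. \<integral>w. ?W n w * iexp (s * V n q w) \<partial>M) \<longlonglongrightarrow> (\<integral>w. ?W' w * iexp (s * V' q w) \<partial>Q)"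
        using insert.IH[of "a(q := a q + s)"] insert.prems unfolding eq by simp
    qed (use h in auto)
    then show ?case using insert.hyps by (simp add: mult_ac)
  qed
  from this[OF F subset_refl, of "\<lambda>_. 0"]
  have "(\<lambda>n. \<integral>w. complex_of_real (\<Prod>p\<in>F. h (V n p w)) \<partial>M) \<longlonglongrightarrow> (\<integral>w. complex_of_real (\<Prod>p\<in>F. h (V' p w)) \<partial>Q)"
    by simp
  then show ?thesis by (simp only: integral_complex_of_real tendsto_of_real_iff)
qed

section \<open>Gaussian limits\<close>

text \<open>
  The degenerate law \<open>v = 0\<close> is included, as it occurs whenever a linear combination of the
  \<open>f p\<close> is almost surely constant.
\<close>

lemma
  assumes "0 \<le> v"
  shows char_normal_law: "(\<integral>x. iexp (s * x) \<partial>normal_law 0 v) = exp (- s\<^sup>2 * v / 2)"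
    and real_distribution_normal_law: "real_distribution (normal_law m v)"
    and square_integrable_normal_law: "integrable (normal_law m v) (\<lambda>x. x\<^sup>2)"
    and expectation_normal_law: "(\<integral>x. x \<partial>normal_law m v) = m"
    and variance_normal_law: "(\<integral>x. (x - m)\<^sup>2 \<partial>normal_law m v) = v"
proof -
  have all: "(\<integral>x. iexp (s * x) \<partial>normal_law 0 v) = exp (- s\<^sup>2 * v / 2) \<and> real_distribution (normal_law m v)
    \<and> integrable (normal_law m v) (\<lambda>x. x\<^sup>2) \<and> (\<integral>x. x \<partial>normal_law m v) = m \<and> (\<integral>x. (x - m)\<^sup>2 \<partial>normal_law m v) = v"
  proof (cases "v = 0")
    case True
    interpret prob_space "return borel m :: real measure" by (rule prob_space_return) simp
    have "real_distribution (return borel m :: real measure)" by unfold_locales simp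
    moreover have "integrable (return borel m) (\<lambda>x::real. x\<^sup>2)"
      by (rule integrableI_bounded) (auto simp: nn_integral_return)
    ultimately show ?thesis using True by (auto simp: normal_law_def integral_return)
  next
    case False
    define \<sigma> where "\<sigma> = sqrt v"
    have \<sigma>: "0 < \<sigma>" "\<sigma>\<^sup>2 = v" using False assms by (auto simp: \<sigma>_def)
    let ?N = "\<lambda>m. density lborel (\<lambda>x. ennreal (normal_density m \<sigma> x))"
    have law: "normal_law m v = ?N m" for m using False by (simp add: normal_law_def \<sigma>_def)
    have prob: "prob_space (?N m)" for m by (rule prob_space_normal_density) fact
    interpret N: prob_space "?N m" by (rule prob)
    interpret N0: prob_space "?N 0" by (rule prob)
    have dist: "distributed (?N m) lborel (\<lambda>x. x) (normal_density m \<sigma>)" for m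
      unfolding distributed_def by (auto simp: distr_id2)
    have "distributed (?N 0) lborel (\<lambda>x. (x - 0) / \<sigma>) std_normal_density"
      using N0.normal_standard_normal_convert[OF \<sigma>(1), of "\<lambda>x. x" 0] dist[of 0] by simp
    then have std: "distr (?N 0) lborel (\<lambda>x. x / \<sigma>) = std_normal_distribution"
      by (simp add: distributed_def)
    have std': "distr (?N 0) borel (\<lambda>x. x / \<sigma>) = std_normal_distribution"
      unfolding std[symmetric] by (rule distr_cong) auto
    have "(\<integral>x. iexp (s * x) \<partial>?N 0) = (\<integral>x. iexp ((s * \<sigma>) * (x / \<sigma>)) \<partial>?N 0)" using \<sigma> by simp
    also have "\<dots> = (\<integral>y. iexp ((s * \<sigma>) * y) \<partial>distr (?N 0) borel (\<lambda>x. x / \<sigma>))"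
      by (subst integral_distr) auto
    also have "\<dots> = char std_normal_distribution (s * \<sigma>)" unfolding std' char_def ..
    also have "\<dots> = exp (- s\<^sup>2 * v / 2)" unfolding char_std_normal_distribution using \<sigma> by (simp add: power_mult_distrib)
    finally have 1: "(\<integral>x. iexp (s * x) \<partial>?N 0) = exp (- s\<^sup>2 * v / 2)" .
    have mean: "N.expectation (\<lambda>x. x) = m"
      using N.normal_distributed_expectation[OF \<sigma>(1) dist] by simp
    have var: "N.variance (\<lambda>x. x) = v"
      using N.normal_distributed_variance[OF \<sigma>(1) dist] \<sigma> by simp
    have "integrable lborel (\<lambda>x. normal_density m \<sigma> x * (x - m)\<^sup>2)"
      by (rule integrable_normal_moment[OF \<sigma>(1)])
    moreover have "integrable lborel (\<lambda>x. normal_density m \<sigma> x * (x - m))"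
      using integrable_normal_moment[OF \<sigma>(1), of m 1] by simp
    ultimately have "integrable (?N m) (\<lambda>x. (x - m)\<^sup>2)" "integrable (?N m) (\<lambda>x. x - m)"
      by (subst integrable_density; simp)+
    then have "integrable (?N m) (\<lambda>x. (x - m)\<^sup>2 + 2 * m * (x - m) + m\<^sup>2)" by auto
    moreover have "(\<lambda>x. (x - m)\<^sup>2 + 2 * m * (x - m) + m\<^sup>2) = (\<lambda>x. x\<^sup>2)"
      by (auto simp: power2_eq_square algebra_simps)
    ultimately have "integrable (?N m) (\<lambda>x. x\<^sup>2)" by simp
    moreover have "real_distribution (?N m)" by unfold_locales simp
    ultimately show ?thesis using 1 mean var by (simp add: law)
  qed
  then show "(\<integral>x. iexp (s * x) \<partial>normal_law 0 v) = exp (- s\<^sup>2 * v / 2)"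
    and "real_distribution (normal_law m v)"
    and "integrable (normal_law m v) (\<lambda>x. x\<^sup>2)"
    and "(\<integral>x. x \<partial>normal_law m v) = m"
    and "(\<integral>x. (x - m)\<^sup>2 \<partial>normal_law m v) = v" by blast+
qed

lemma (in prob_space)
  fixes Z :: "'p \<Rightarrow> 'a \<Rightarrow> real"
  assumes meas [measurable]: "\<And>p. p \<in> F \<Longrightarrow> Z p \<in> borel_measurable M"
    and sq: "\<And>p. p \<in> F \<Longrightarrow> integrable M (\<lambda>w. (Z p w)\<^sup>2)"
  shows variance_linear_combination: "variance (\<lambda>w. \<Sum>p\<in>F. a p * Z p w) = (\<Sum>p\<in>F. \<Sum>q\<in>F. a p * a q * covariance M (Z p) (Z q))"
    and square_integrable_linear_combination: "integrable M (\<lambda>w. (\<Sum>p\<in>F. a p * Z p w)\<^sup>2)"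
proof -
  have prod: "integrable M (\<lambda>w. x w * y w)"
    if "integrable M (\<lambda>w. (x w)\<^sup>2)" "integrable M (\<lambda>w. (y w)\<^sup>2)"
      "x \<in> borel_measurable M" "y \<in> borel_measurable M" for x y :: "'a \<Rightarrow> real"
  proof (rule Bochner_Integration.integrable_bound)
    show "integrable M (\<lambda>w. (x w)\<^sup>2 + (y w)\<^sup>2)" using that by simp
    have "norm (x w * y w) \<le> norm ((x w)\<^sup>2 + (y w)\<^sup>2)" for w
    proof -
      have "0 \<le> \<bar>x w\<bar> * \<bar>y w\<bar>" by simp
      then have "\<bar>x w\<bar> * \<bar>y w\<bar> \<le> (x w)\<^sup>2 + (y w)\<^sup>2"
        using sum_squares_bound[of "\<bar>x w\<bar>" "\<bar>y w\<bar>"] unfolding mult.assoc power2_abs by linarith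
      then show ?thesis by (simp add: abs_mult)
    qed
    then show "AE w in M. norm (x w * y w) \<le> norm ((x w)\<^sup>2 + (y w)\<^sup>2)" by simp
  qed (use that in simp)
  have int: "integrable M (Z p)" if "p \<in> F" for p
    by (rule square_integrable_imp_integrable[OF _ sq[OF that]]) (use that in auto)
  define Z' where "Z' p w = Z p w - expectation (Z p)" for p w
  have [measurable]: "Z' p \<in> borel_measurable M" if "p \<in> F" for p
    using that unfolding Z'_def[abs_def] by measurable
  have sq': "integrable M (\<lambda>w. (Z' p w)\<^sup>2)" if "p \<in> F" for p
    using int[OF that] sq[OF that] by (simp add: Z'_def power2_diff)
  have mean: "expectation (\<lambda>w. \<Sum>p\<in>F. a p * Z p w) = (\<Sum>p\<in>F. a p * expectation (Z p))"
    using int by simp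
  have sqsum: "(\<Sum>p\<in>F. a p * X p)\<^sup>2 = (\<Sum>p\<in>F. \<Sum>q\<in>F. a p * a q * (X p * X q))" for X :: "'p \<Rightarrow> real"
    by (simp add: power2_eq_square sum_product mult_ac)
  have "variance (\<lambda>w. \<Sum>p\<in>F. a p * Z p w) = expectation (\<lambda>w. (\<Sum>p\<in>F. a p * Z' p w)\<^sup>2)"
    unfolding mean by (simp add: Z'_def right_diff_distrib sum_subtractf)
  also have "\<dots> = (\<Sum>p\<in>F. \<Sum>q\<in>F. a p * a q * expectation (\<lambda>w. Z' p w * Z' q w))"
    unfolding sqsum using prod[OF sq' sq'] by simp
  finally show "variance (\<lambda>w. \<Sum>p\<in>F. a p * Z p w) = (\<Sum>p\<in>F. \<Sum>q\<in>F. a p * a q * covariance M (Z p) (Z q))"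
    by (simp add: covariance_def Z'_def)
  show "integrable M (\<lambda>w. (\<Sum>p\<in>F. a p * Z p w)\<^sup>2)"
    unfolding sqsum using prod[OF sq sq] by simp
qed

text \<open>
  The definition of a Gaussian element leaves mean and variance of a linear combination unspecified. They are
  recovered from the moments of the single coordinates, which are square integrable because they are normal
  themselves.
\<close>

lemma char_linear_combination_centred_gaussian:
  assumes "prob_space Q" and Y: "centred_gaussian_in_C Q I k Y" and F: "finite F" "F \<subseteq> I"
  shows "(\<integral>w. iexp (\<Sum>p\<in>F. a p * Y p w) \<partial>Q) = exp (- (\<Sum>p\<in>F. \<Sum>q\<in>F. a p * a q * k p q) / 2)"
proof -
  interpret Q: prob_space Q by fact
  have meas [measurable]: "Y p \<in> borel_measurable Q" if "p \<in> I" for p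
    using Y that by (simp add: centred_gaussian_in_C_def)
  have lin: "\<exists>m v. 0 \<le> v \<and> distr Q borel (\<lambda>w. \<Sum>p\<in>H. a p * Y p w) = normal_law m v" if "finite H" "H \<subseteq> I" for H a
    using Y that by (simp add: centred_gaussian_in_C_def)
  have mean: "Q.expectation (Y p) = 0" if "p \<in> I" for p
    using Y that by (simp add: centred_gaussian_in_C_def)
  have cov: "covariance Q (Y p) (Y q) = k p q" if "p \<in> I" "q \<in> I" for p q
    using Y that by (simp add: centred_gaussian_in_C_def)
  have sq: "integrable Q (\<lambda>w. (Y p w)\<^sup>2)" if p: "p \<in> I" for p
  proof -
    obtain m v where mv: "0 \<le> v" "distr Q borel (\<lambda>w. \<Sum>p\<in>{p}. 1 * Y p w) = normal_law m v"
      using lin[of "{p}" "\<lambda>_. 1"] p by auto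
    have "integrable (distr Q borel (Y p)) (\<lambda>x. x\<^sup>2)"
      using mv(2) square_integrable_normal_law[OF mv(1), of m] by simp
    then show ?thesis using p by (simp add: integrable_distr_eq)
  qed
  have int: "integrable Q (Y p)" if "p \<in> I" for p
    by (rule Q.square_integrable_imp_integrable[OF _ sq[OF that]]) (use that in auto)
  have F': "\<And>p. p \<in> F \<Longrightarrow> p \<in> I" using F by auto
  let ?L = "\<lambda>w. \<Sum>p\<in>F. a p * Y p w"
  have L [measurable]: "?L \<in> borel_measurable Q" using F' by measurable
  obtain m v where mv: "0 \<le> v" "distr Q borel ?L = normal_law m v" using lin[OF F] by blast
  have EL: "Q.expectation ?L = 0" using int mean F' by simp
  have "m = (\<integral>x. x \<partial>distr Q borel ?L)" using expectation_normal_law[OF mv(1), of m] mv(2) by simp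
  also have "\<dots> = 0" using EL by (subst integral_distr) auto
  finally have m: "m = 0" .
  have "v = (\<integral>x. (x - m)\<^sup>2 \<partial>distr Q borel ?L)" using variance_normal_law[OF mv(1), of m] mv(2) by simp
  also have "\<dots> = Q.variance ?L" unfolding EL m by (subst integral_distr) auto
  also have "\<dots> = (\<Sum>p\<in>F. \<Sum>q\<in>F. a p * a q * covariance Q (Y p) (Y q))"
    by (rule Q.variance_linear_combination) (use F' sq in auto)
  also have "\<dots> = (\<Sum>p\<in>F. \<Sum>q\<in>F. a p * a q * k p q)"
    by (intro sum.cong refl) (simp add: cov F')
  finally have v: "v = (\<Sum>p\<in>F. \<Sum>q\<in>F. a p * a q * k p q)" .
  have "(\<integral>w. iexp (?L w) \<partial>Q) = (\<integral>x. iexp x \<partial>distr Q borel ?L)"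
    by (subst integral_distr) auto
  also have "\<dots> = exp (- v / 2)" unfolding mv(2) m using char_normal_law[OF mv(1), of 1] by simp
  finally show ?thesis unfolding v by simp
qed

context iid_sample
begin

text \<open>
  If the variance vanishes, \<open>h\<close> is almost surely constant and the process is almost surely zero;
  otherwise this is the central limit theorem, with its characteristic function evaluated at the standard deviation.
\<close>

lemma char_empirical_process:
  assumes [measurable]: "h \<in> borel_measurable P" and sq: "integrable P (\<lambda>z. (h z)\<^sup>2)"
  shows "(\<lambda>n. expectation (\<lambda>w. iexp (empirical_process n h w))) \<longlonglongrightarrow> exp (- P.variance h / 2)"
proof -
  define \<sigma> where "\<sigma> = sqrt (P.variance h)"
  have v: "0 \<le> P.variance h" by (rule integral_nonneg_AE) simp
  then have \<sigma>2: "\<sigma>\<^sup>2 = P.variance h" "0 \<le> \<sigma>" by (simp_all add: \<sigma>_def)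
  let ?h = "\<lambda>z. h z - P.expectation h"
  have inth: "integrable P h"
    by (rule P.square_integrable_imp_integrable[OF _ sq]) auto
  have sq': "integrable P (\<lambda>z. (?h z)\<^sup>2)" using inth sq by (simp add: power2_diff)
  show ?thesis
  proof (cases "\<sigma> = 0")
    case True
    have "AE z in P. (?h z)\<^sup>2 = 0"
      using integral_nonneg_eq_0_iff_AE[OF sq'] True \<sigma>2 by simp
    then have "AE z in distr M P (\<eta> i). ?h z = 0" for i unfolding law by simp
    then have "AE w in M. ?h (\<eta> i w) = 0" for i by (rule AE_distrD[OF measurable_sample])
    then have "AE w in M. \<forall>i. ?h (\<eta> i w) = 0" by (simp add: AE_all_countable)
    then have "expectation (\<lambda>w. iexp (empirical_process n h w)) = expectation (\<lambda>w. 1)" for n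
      by (intro integral_cong_AE) (auto simp: empirical_process_def)
    then show ?thesis using True \<sigma>2 by (simp add: prob_space)
  next
    case False
    then have \<sigma>: "0 < \<sigma>" using \<sigma>2 by simp
    let ?X = "\<lambda>i w. ?h (\<eta> i w)"
    have mX: "expectation (?X i) = 0" for i
      using expectation_sample[of ?h i] inth by (simp add: P.prob_space)
    have "weak_conv_m (\<lambda>n. distr M borel (\<lambda>w. (\<Sum>i<n. ?X i w) / sqrt (n * \<sigma>\<^sup>2))) std_normal_distribution"
    proof (rule central_limit_theorem_zero_mean[OF _ _ \<sigma>])
      show "indep_vars (\<lambda>i. borel) ?X UNIV"
        by (rule indep_vars_compose2[OF indep]) auto
      show "expectation (?X i) = 0" for i by (rule mX)
      show "integrable M (\<lambda>w. (?X i w)\<^sup>2)" for i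
        using integrable_sample_iff[of "\<lambda>z. (?h z)\<^sup>2" i] sq' by simp
      show "variance (?X i) = \<sigma>\<^sup>2" for i
        unfolding mX \<sigma>2 using expectation_sample[of "\<lambda>z. (?h z)\<^sup>2" i] by simp
      show "distr M borel (?X i) = distr P borel ?h" for i
      proof -
        have "distr (distr M P (\<eta> i)) borel ?h = distr M borel (?h \<circ> \<eta> i)"
          by (rule distr_distr) auto
        then show ?thesis by (simp add: law comp_def)
      qed
    qed
    from levy_continuity1[OF real_distribution_distr real_dist_normal_dist this, of \<sigma>]
    have "(\<lambda>n. char (distr M borel (\<lambda>w. (\<Sum>i<n. ?X i w) / sqrt (n * \<sigma>\<^sup>2))) \<sigma>) \<longlonglongrightarrow> exp (- \<sigma>\<^sup>2 / 2)"
      by (simp add: char_std_normal_distribution)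
    moreover have "char (distr M borel (\<lambda>w. (\<Sum>i<n. ?X i w) / sqrt (n * \<sigma>\<^sup>2))) \<sigma>
      = expectation (\<lambda>w. iexp (empirical_process n h w))" for n
    proof -
      have "\<sigma> * ((\<Sum>i<n. ?X i w) / sqrt (n * \<sigma>\<^sup>2)) = empirical_process n h w" for w
        using \<sigma> by (simp add: empirical_process_def real_sqrt_mult)
      then show ?thesis by (simp add: char_def integral_distr flip: of_real_mult)
    qed
    ultimately show ?thesis by (simp add: \<sigma>2)
  qed
qed

end

context lipschitz_sample
begin

lemma char_linear_combination_G:
  assumes F: "finite F" "F \<subseteq> D"
  shows "(\<lambda>n. expectation (\<lambda>w. iexp (\<Sum>p\<in>F. a p * G n p w)))
    \<longlonglongrightarrow> exp (- (\<Sum>p\<in>F. \<Sum>q\<in>F. a p * a q * covariance P (f p) (f q)) / 2)"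
proof -
  have F': "\<And>p. p \<in> F \<Longrightarrow> p \<in> D" using F by auto
  have "empirical_process n (\<lambda>z. \<Sum>p\<in>H. a p * f p z) w = (\<Sum>p\<in>H. a p * G n p w)" if "finite H" "H \<subseteq> D" for H n w
    using that
  proof (induction H rule: finite_induct)
    case empty
    then show ?case by (simp add: empirical_process_def)
  next
    case (insert p H)
    then show ?case
      by (simp add: empirical_process_add empirical_process_cmult f_integrable subset_iff)
  qed
  note lin = this[OF F]
  have var: "P.variance (\<lambda>z. \<Sum>p\<in>F. a p * f p z) = (\<Sum>p\<in>F. \<Sum>q\<in>F. a p * a q * covariance P (f p) (f q))"
    by (rule P.variance_linear_combination) (use F' f_square in auto)
  have "(\<lambda>z. \<Sum>p\<in>F. a p * f p z) \<in> borel_measurable P" using F' by measurable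
  moreover have "integrable P (\<lambda>z. (\<Sum>p\<in>F. a p * f p z)\<^sup>2)"
    by (rule P.square_integrable_linear_combination) (use F' f_square in auto)
  ultimately show ?thesis
    using char_empirical_process[of "\<lambda>z. \<Sum>p\<in>F. a p * f p z"] unfolding lin var by simp
qed

end

section \<open>Infima of processes with a growing penalty\<close>

lemma dense_sequence:
  fixes S :: "'p::euclidean_space set"
  assumes "S \<noteq> {}"
  obtains t :: "nat \<Rightarrow> 'p" where "range t \<subseteq> S" "S \<subseteq> closure (range t)"
proof -
  obtain T where T: "countable T" "T \<subseteq> S" "S \<subseteq> closure T" using separable by blast
  then have "T \<noteq> {}" using assms by auto
  then have "range (from_nat_into T) = T" using T(1) by (rule range_from_nat_into)
  with T that[of "from_nat_into T"] show thesis by simp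
qed

lemma bdd_below_image_compact:
  fixes g :: "'p::topological_space \<Rightarrow> real"
  assumes "compact S" "continuous_on S g"
  shows "bdd_below (g ` S)"
  using compact_continuous_image[OF assms(2,1)] by (intro bounded_imp_bdd_below compact_imp_bounded)

text \<open>
  A dense sequence decides whether an infimum over a compact set reaches a level, which turns the corresponding events
  into countable intersections.
\<close>

lemma le_INF_dense_iff:
  fixes g :: "'p::euclidean_space \<Rightarrow> real"
  assumes S: "compact S" "S \<noteq> {}" and g: "continuous_on S g"
    and t: "range t \<subseteq> S" "S \<subseteq> closure (range t)"
  shows "c \<le> (INF p\<in>S. g p) \<longleftrightarrow> (\<forall>i::nat. c \<le> g (t i))"
proof
  assume "c \<le> (INF p\<in>S. g p)"
  then show "\<forall>i. c \<le> g (t i)"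
    using t(1) cINF_lower[OF bdd_below_image_compact[OF S(1) g]] by (blast intro: order_trans)
next
  assume *: "\<forall>i. c \<le> g (t i)"
  have "closed (S \<inter> g -` {c..})"
    by (rule continuous_closed_preimage[OF g compact_imp_closed[OF S(1)] closed_atLeast])
  moreover have "range t \<subseteq> S \<inter> g -` {c..}" using * t by auto
  ultimately have "closure (range t) \<subseteq> S \<inter> g -` {c..}" by (intro closure_minimal)
  then show "c \<le> (INF p\<in>S. g p)" using t S by (intro cINF_greatest) auto
qed

lemma borel_measurable_INF_compact:
  fixes S :: "'p::euclidean_space set" and Y :: "'p \<Rightarrow> 'q \<Rightarrow> real"
  assumes S: "compact S" "S \<noteq> {}"
    and meas: "\<And>p. p \<in> S \<Longrightarrow> Y p \<in> borel_measurable Q"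
    and cont: "\<And>w. w \<in> space Q \<Longrightarrow> continuous_on S (\<lambda>p. Y p w)"
  shows "(\<lambda>w. INF p\<in>S. Y p w) \<in> borel_measurable Q"
proof -
  obtain t :: "nat \<Rightarrow> 'p" where t: "range t \<subseteq> S" "S \<subseteq> closure (range t)" using dense_sequence[OF S(2)] .
  have [measurable]: "Y (t i) \<in> borel_measurable Q" for i using t meas by auto
  have "{w \<in> space Q. c \<le> (INF p\<in>S. Y p w)} = {w \<in> space Q. \<forall>i. c \<le> Y (t i) w}" for c
    using le_INF_dense_iff[OF S cont t] by blast
  then show ?thesis unfolding borel_measurable_iff_ge by simp
qed

text \<open>
  A continuous step from 0 at \<open>a\<close> to 1 at \<open>b\<close>. Products of such steps approximate the
  indicator of the event that all coordinates exceed a level.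
\<close>

definition ramp :: "real \<Rightarrow> real \<Rightarrow> real \<Rightarrow> real"
  where "ramp a b x = max 0 (min 1 ((x - a) / (b - a)))"

lemma ramp_properties:
  assumes "a < b"
  shows "isCont (ramp a b) x" "0 \<le> ramp a b x" "ramp a b x \<le> 1" "\<bar>ramp a b x\<bar> \<le> 1"
    "b \<le> x \<Longrightarrow> ramp a b x = 1" "0 < ramp a b x \<Longrightarrow> a < x"
proof -
  show "isCont (ramp a b) x" unfolding ramp_def[abs_def] using assms by (intro continuous_intros) auto
  show "b \<le> x \<Longrightarrow> ramp a b x = 1" "0 < ramp a b x \<Longrightarrow> a < x"
    using assms by (auto simp: ramp_def field_simps max_def min_def zero_less_divide_iff split: if_splits)
qed (auto simp: ramp_def)

lemma (in prob_space)
  assumes "finite F" and meas [measurable]: "\<And>p. p \<in> F \<Longrightarrow> V p \<in> borel_measurable M" and "a < b"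
  shows prob_le_expectation_ramp: "prob {w \<in> space M. \<forall>p\<in>F. b \<le> V p w} \<le> expectation (\<lambda>w. \<Prod>p\<in>F. ramp a b (V p w))"
    and expectation_ramp_le_prob: "expectation (\<lambda>w. \<Prod>p\<in>F. ramp a b (V p w)) \<le> prob {w \<in> space M. \<forall>p\<in>F. a < V p w}"
proof -
  have [measurable]: "ramp a b \<in> borel_measurable borel"
    using ramp_properties(1)[OF \<open>a < b\<close>] by (intro borel_measurable_continuous_onI continuous_at_imp_continuous_on) auto
  have [measurable]: "(\<lambda>w. \<Prod>p\<in>F. ramp a b (V p w)) \<in> borel_measurable M"
    by (intro borel_measurable_prod) measurable
  have sets: "{w \<in> space M. \<forall>p\<in>F. b \<le> V p w} \<in> sets M" "{w \<in> space M. \<forall>p\<in>F. a < V p w} \<in> sets M"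
    using \<open>finite F\<close> by (auto intro!: sets.sets_Collect_finite_All borel_measurable_le borel_measurable_less)
  have prod: "0 \<le> (\<Prod>p\<in>F. ramp a b (V p w))" "(\<Prod>p\<in>F. ramp a b (V p w)) \<le> 1" for w
    using ramp_properties[OF \<open>a < b\<close>] by (auto intro!: prod_nonneg prod_le_1)
  have int: "integrable M (\<lambda>w. \<Prod>p\<in>F. ramp a b (V p w))"
    by (rule integrable_bounded[of _ 1]) (use prod in auto)
  have "prob {w \<in> space M. \<forall>p\<in>F. b \<le> V p w} = expectation (indicator {w \<in> space M. \<forall>p\<in>F. b \<le> V p w})"
    using sets by simp
  also have "\<dots> \<le> expectation (\<lambda>w. \<Prod>p\<in>F. ramp a b (V p w))"
    using sets int prod ramp_properties(5)[OF \<open>a < b\<close>]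
    by (intro integral_mono) (auto simp: indicator_def simp: emeasure_eq_measure intro!: integrable_real_indicator)
  finally show "prob {w \<in> space M. \<forall>p\<in>F. b \<le> V p w} \<le> expectation (\<lambda>w. \<Prod>p\<in>F. ramp a b (V p w))" .
  have "expectation (\<lambda>w. \<Prod>p\<in>F. ramp a b (V p w)) \<le> expectation (indicator {w \<in> space M. \<forall>p\<in>F. a < V p w})"
  proof (rule integral_mono[OF int])
    fix w assume w: "w \<in> space M"
    have "(\<Prod>p\<in>F. ramp a b (V p w)) = 0" if "p \<in> F" "\<not> a < V p w" for p
    proof -
      have "ramp a b (V p w) = 0" using that ramp_properties(2)[OF \<open>a < b\<close>, of "V p w"] ramp_properties(6)[OF \<open>a < b\<close>, of "V p w"] by linarith
      then show ?thesis using \<open>finite F\<close> that by (metis prod_zero)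
    qed
    then show "(\<Prod>p\<in>F. ramp a b (V p w)) \<le> indicator {w \<in> space M. \<forall>p\<in>F. a < V p w} w"
      using prod w by (auto simp: indicator_def)
  qed (use sets in \<open>auto simp: emeasure_eq_measure intro!: integrable_real_indicator\<close>)
  also have "\<dots> = prob {w \<in> space M. \<forall>p\<in>F. a < V p w}" using sets by simp
  finally show "expectation (\<lambda>w. \<Prod>p\<in>F. ramp a b (V p w)) \<le> prob {w \<in> space M. \<forall>p\<in>F. a < V p w}" .
qed

context lipschitz_sample
begin

definition penalized_infimum :: "('p \<Rightarrow> real) \<Rightarrow> nat \<Rightarrow> 'w \<Rightarrow> real"
  where "penalized_infimum \<phi> n w = (INF p\<in>D. G n p w + sqrt (real n) * \<phi> p)"

lemma borel_measurable_penalized_infimum: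
  assumes "D \<noteq> {}" "continuous_on D \<phi>"
  shows "penalized_infimum \<phi> n \<in> borel_measurable M"
  unfolding penalized_infimum_def[abs_def]
proof (rule borel_measurable_INF_compact[OF compact_D \<open>D \<noteq> {}\<close>])
  show "(\<lambda>w. G n p w + sqrt (real n) * \<phi> p) \<in> borel_measurable M" if "p \<in> D" for p
    using that by measurable
qed (intro continuous_intros continuous_on_G assms)

text \<open>
  It is enough to bound the probability that the infimum exceeds a level \<open>c\<close> from above by the limit
  probability of \<open>{c..}\<close> and from below by that of \<open>{c<..}\<close>, since these agree at continuity
  points. The upper bound uses only that \<open>\<phi>\<close> vanishes on \<open>S\<close>. The lower bound uses
  equicontinuity near a finite net of \<open>S\<close> and, elsewhere, that \<open>\<phi>\<close> has a positive
  minimum \<open>\<kappa>\<close> there while \<open>G n\<close> stays bounded in probability.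
\<close>

theorem penalized_infimum_converges:
  fixes \<phi> :: "'p \<Rightarrow> real" and Q :: "'q measure" and Y :: "'p \<Rightarrow> 'q \<Rightarrow> real"
  assumes \<phi>: "continuous_on D \<phi>" "\<And>p. p \<in> D \<Longrightarrow> 0 \<le> \<phi> p"
    and S: "S = {p \<in> D. \<phi> p = 0}" "S \<noteq> {}"
    and Q: "prob_space Q"
    and Y: "\<And>p. p \<in> S \<Longrightarrow> Y p \<in> borel_measurable Q" "\<And>w. w \<in> space Q \<Longrightarrow> continuous_on S (\<lambda>p. Y p w)"
    and fidi: "\<And>F a. finite F \<Longrightarrow> F \<subseteq> S \<Longrightarrow>
      (\<lambda>n. expectation (\<lambda>w. iexp (\<Sum>p\<in>F. a p * G n p w))) \<longlonglongrightarrow> (\<integral>w. iexp (\<Sum>p\<in>F. a p * Y p w) \<partial>Q)"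
  shows "weak_conv_m (\<lambda>n. distr M borel (penalized_infimum \<phi> n)) (distr Q borel (\<lambda>w. INF p\<in>S. Y p w))"
proof -
  interpret Q: prob_space Q by fact
  define Z where "Z = penalized_infimum \<phi>"
  define I where "I w = (INF p\<in>S. Y p w)" for w
  have SD: "S \<subseteq> D" and D: "D \<noteq> {}" using S by auto
  have "closed (D \<inter> \<phi> -` {0})"
    by (rule continuous_closed_preimage[OF \<phi>(1) compact_imp_closed[OF compact_D] closed_singleton])
  moreover have "D \<inter> \<phi> -` {0} = S" using S by auto
  ultimately have cS: "compact S" using compact_Int_closed[OF compact_D, of S] SD by (simp add: Int_absorb1)
  have Zm [measurable]: "Z n \<in> borel_measurable M" for n
    unfolding Z_def using D \<phi>(1) by (rule borel_measurable_penalized_infimum)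
  have Im [measurable]: "I \<in> borel_measurable Q"
    unfolding I_def[abs_def] using cS S(2) Y by (rule borel_measurable_INF_compact)
  obtain t :: "nat \<Rightarrow> 'p" where t: "range t \<subseteq> S" "S \<subseteq> closure (range t)" using dense_sequence[OF S(2)] .
  have I_ge: "c \<le> I w \<longleftrightarrow> (\<forall>i. c \<le> Y (t i) w)" if "w \<in> space Q" for c w
    unfolding I_def using le_INF_dense_iff[OF cS S(2) Y(2)[OF that] t] .
  have I_le: "I w \<le> Y p w" if "w \<in> space Q" "p \<in> S" for w p
    unfolding I_def using bdd_below_image_compact[OF cS Y(2)[OF that(1)]] that(2) by (rule cINF_lower)
  have contZ: "continuous_on D (\<lambda>p. G n p w + sqrt (real n) * \<phi> p)" if "w \<in> space M" for n w
    using that by (intro continuous_intros continuous_on_G \<phi>)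
  have Z_le: "Z n w \<le> G n p w + sqrt (real n) * \<phi> p" if "w \<in> space M" "p \<in> D" for n p w
    unfolding Z_def penalized_infimum_def
    using bdd_below_image_compact[OF compact_D contZ[OF that(1)]] that(2) by (rule cINF_lower)
  have products: "(\<lambda>n. expectation (\<lambda>w. \<Prod>p\<in>F. ramp a b (G n p w))) \<longlonglongrightarrow> Q.expectation (\<lambda>w. \<Prod>p\<in>F. ramp a b (Y p w))"
    if "finite F" "F \<subseteq> S" "a < b" for F a b
    by (rule cramer_wold_products[OF prob_space_axioms Q \<open>finite F\<close>]) (use that SD Y fidi ramp_properties[OF \<open>a < b\<close>] in auto)
  have GM: "G n p \<in> borel_measurable M" if "p \<in> S" for n p using that SD by auto

  have upper: "\<forall>\<^sub>F n in sequentially. prob {w \<in> space M. c < Z n w} \<le> Q.prob {w \<in> space Q. c \<le> I w} + e"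
    if e: "0 < e" for c e
  proof -
    \<comment> \<open>these events decrease to \<open>c \<le> I w\<close>, because \<open>t\<close> is dense in \<open>S\<close>\<close>
    define A where "A k = {w \<in> space Q. \<forall>p\<in>t ` {..k}. c - 1 / real (Suc k) < Y p w}" for k
    have A_sets: "A k \<in> sets Q" for k
      unfolding A_def using t Y(1) by (auto intro!: sets.sets_Collect_finite_All borel_measurable_less)
    have "(\<lambda>k. Q.prob (A k)) \<longlonglongrightarrow> Q.prob (\<Inter>k. A k)"
    proof (rule Q.finite_Lim_measure_decseq)
      show "decseq A"
        unfolding decseq_Suc_iff
      proof (intro allI subsetI)
        fix k w assume w: "w \<in> A (Suc k)"
        have "1 / real (Suc (Suc k)) \<le> 1 / real (Suc k)" by (simp add: frac_le)
        moreover have "c - 1 / real (Suc (Suc k)) < Y (t i) w" if "i \<le> k" for i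
          using w that by (auto simp: A_def simp del: of_nat_Suc)
        ultimately have "c - 1 / real (Suc k) < Y (t i) w" if "i \<le> k" for i
          using that by (smt (verit))
        then show "w \<in> A k" using w by (auto simp: A_def simp del: of_nat_Suc)
      qed
    qed (use A_sets in auto)
    also have "(\<Inter>k. A k) = {w \<in> space Q. c \<le> I w}"
    proof (intro subset_antisym subsetI)
      fix w assume w: "w \<in> (\<Inter>k. A k)"
      then have sp: "w \<in> space Q" by (auto simp: A_def)
      have "c \<le> Y (t i) w" for i
      proof (rule LIMSEQ_le_const2)
        show "(\<lambda>k. c - 1 / real (Suc k)) \<longlonglongrightarrow> c"
          using tendsto_diff[OF tendsto_const lim_1_over_n[THEN LIMSEQ_Suc], of c] by simp
        show "\<exists>N. \<forall>k\<ge>N. c - 1 / real (Suc k) \<le> Y (t i) w"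
          using w by (intro exI[of _ i]) (auto simp: A_def simp del: of_nat_Suc intro!: less_imp_le)
      qed
      then show "w \<in> {w \<in> space Q. c \<le> I w}" using sp I_ge by auto
    next
      fix w assume w: "w \<in> {w \<in> space Q. c \<le> I w}"
      have "c - 1 / real (Suc k) < Y (t i) w" for k i
      proof -
        have "c \<le> Y (t i) w" using w I_ge by auto
        moreover have "0 < 1 / real (Suc k)" by simp
        ultimately show ?thesis by linarith
      qed
      then show "w \<in> (\<Inter>k. A k)" using w by (auto simp: A_def)
    qed
    finally have "\<forall>\<^sub>F k in sequentially. Q.prob (A k) < Q.prob {w \<in> space Q. c \<le> I w} + e"
      by (rule order_tendstoD) (use e in simp)
    then obtain k where k: "Q.prob (A k) < Q.prob {w \<in> space Q. c \<le> I w} + e"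
      by (meson eventually_sequentially order_refl)
    define F where "F = t ` {..k}"
    define a where "a = c - 1 / real (Suc k)"
    have F: "finite F" "F \<subseteq> S" and a: "a < c" using t by (auto simp: F_def a_def)
    have "Q.expectation (\<lambda>w. \<Prod>p\<in>F. ramp a c (Y p w)) \<le> Q.prob (A k)"
      unfolding A_def F_def[symmetric] a_def[symmetric]
      by (rule Q.expectation_ramp_le_prob) (use F a Y in auto)
    then have "Q.expectation (\<lambda>w. \<Prod>p\<in>F. ramp a c (Y p w)) < Q.prob {w \<in> space Q. c \<le> I w} + e" using k by linarith
    from order_tendstoD(2)[OF products[OF F a] this]
    show ?thesis
    proof eventually_elim
      case (elim n)
      have "prob {w \<in> space M. c < Z n w} \<le> prob {w \<in> space M. \<forall>p\<in>F. c \<le> G n p w}"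
      proof (rule finite_measure_mono)
        show "{w \<in> space M. c < Z n w} \<subseteq> {w \<in> space M. \<forall>p\<in>F. c \<le> G n p w}"
        proof clarsimp
          fix w p assume w: "w \<in> space M" "c < Z n w" "p \<in> F"
          then have "p \<in> D" "\<phi> p = 0" using F S by auto
          then show "c \<le> G n p w" using Z_le[OF w(1), of p n] w by simp
        qed
        show "{w \<in> space M. \<forall>p\<in>F. c \<le> G n p w} \<in> sets M"
          using F GM by (auto intro!: sets.sets_Collect_finite_All borel_measurable_le)
      qed
      also have "\<dots> \<le> expectation (\<lambda>w. \<Prod>p\<in>F. ramp a c (G n p w))"
        by (rule prob_le_expectation_ramp) (use F a GM in auto)
      finally show ?case using elim by linarith
    qed
  qed

  have lower: "\<forall>\<^sub>F n in sequentially. Q.prob {w \<in> space Q. c < I w} - e \<le> prob {w \<in> space M. c < Z n w}"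
    if e: "0 < e" for c e
  proof -
    \<comment> \<open>these events increase to \<open>c < I w\<close>\<close>
    define A where "A k = {w \<in> space Q. c + 1 / real (Suc k) \<le> I w}" for k
    have "(\<lambda>k. Q.prob (A k)) \<longlonglongrightarrow> Q.prob (\<Union>k. A k)"
    proof (rule Q.finite_Lim_measure_incseq)
      show "incseq A"
        unfolding incseq_Suc_iff
      proof (intro allI subsetI)
        fix k w assume w: "w \<in> A k"
        have "1 / real (Suc (Suc k)) \<le> 1 / real (Suc k)" by (simp add: frac_le)
        then show "w \<in> A (Suc k)" using w by (auto simp: A_def)
      qed
    qed (auto simp: A_def)
    also have "(\<Union>k. A k) = {w \<in> space Q. c < I w}"
    proof (intro subset_antisym subsetI)
      fix w assume "w \<in> (\<Union>k. A k)"
      then obtain k where w: "w \<in> space Q" "c + 1 / real (Suc k) \<le> I w" by (auto simp: A_def)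
      moreover have "0 < 1 / real (Suc k)" by simp
      ultimately have "c < I w" by linarith
      with w(1) show "w \<in> {w \<in> space Q. c < I w}" by simp
    next
      fix w assume w: "w \<in> {w \<in> space Q. c < I w}"
      then have "0 < I w - c" by simp
      then obtain k where "1 / real (Suc k) < I w - c" by (rule nat_approx_posE)
      then have "w \<in> A k" using w by (simp add: A_def del: of_nat_Suc)
      then show "w \<in> (\<Union>k. A k)" by blast
    qed
    finally have "\<forall>\<^sub>F k in sequentially. Q.prob {w \<in> space Q. c < I w} - e / 4 < Q.prob (A k)"
      by (rule order_tendstoD) (use e in simp)
    then obtain k where k: "Q.prob {w \<in> space Q. c < I w} - e / 4 < Q.prob (A k)"
      by (meson eventually_sequentially order_refl)
    \<comment> \<open>three margins: one for the oscillation of \<open>G n\<close>, one for the ramp, one to stay strictly above \<open>c\<close>\<close>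
    define \<epsilon> where "\<epsilon> = 1 / real (Suc k) / 3"
    have \<epsilon>: "0 < \<epsilon>" and "3 * \<epsilon> = 1 / real (Suc k)" by (simp_all add: \<epsilon>_def del: of_nat_Suc)
    then have Ak: "A k = {w \<in> space Q. c + 3 * \<epsilon> \<le> I w}" by (simp only: A_def)
    obtain \<delta> where \<delta>: "0 < \<delta>" "\<And>n. 0 < n \<Longrightarrow> \<exists>B\<in>sets M. prob B \<le> e / 4 \<and>
      (\<forall>w\<in>space M - B. \<forall>p\<in>D. \<forall>q\<in>D. dist p q \<le> \<delta> \<longrightarrow> \<bar>G n p w - G n q w\<bar> \<le> \<epsilon>)"
      using asymptotic_equicontinuity[OF \<epsilon>, of "e / 4"] e by auto
    obtain C where C: "\<And>n. 0 < n \<Longrightarrow> \<exists>B\<in>sets M. prob B \<le> e / 4 \<and> (\<forall>w\<in>space M - B. \<forall>p\<in>D. \<bar>G n p w\<bar> \<le> C)"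
      using empirical_process_bounded_in_probability[of "e / 4"] e by auto
    obtain F where F: "finite F" "F \<subseteq> S" "S \<subseteq> (\<Union>p\<in>F. ball p \<delta>)"
      using seq_compact_imp_totally_bounded[OF compact_imp_seq_compact[OF cS], rule_format, OF \<delta>(1)]
      by (elim exE conjE) rule
    \<comment> \<open>by compactness \<open>\<phi>\<close> is bounded away from 0 outside the balls around the net\<close>
    define far where "far = D - (\<Union>p\<in>F. ball p \<delta>)"
    obtain \<kappa> where \<kappa>: "0 < \<kappa>" "\<And>p. p \<in> far \<Longrightarrow> \<kappa> \<le> \<phi> p"
    proof (cases "far = {}")
      case True
      then show ?thesis using that[of 1] by auto
    next
      case False
      have "compact far" unfolding far_def by (intro compact_diff compact_D open_UN) auto
      moreover have "continuous_on far \<phi>" using \<phi>(1) by (rule continuous_on_subset) (auto simp: far_def)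
      ultimately obtain p0 where p0: "p0 \<in> far" "\<And>p. p \<in> far \<Longrightarrow> \<phi> p0 \<le> \<phi> p"
        using continuous_attains_inf[OF _ False] by metis
      have "p0 \<in> D" "p0 \<notin> S" using p0(1) F(3) by (auto simp: far_def)
      then have "0 < \<phi> p0" using \<phi>(2)[of p0] S(1) by auto
      with p0 that show ?thesis by blast
    qed
    have "filterlim (\<lambda>n. sqrt (real n) * \<kappa>) at_top sequentially"
      using \<kappa> by (intro filterlim_at_top_mult_tendsto_pos[where c=\<kappa>] tendsto_const
        filterlim_compose[OF sqrt_at_top filterlim_real_sequentially]) auto
    then have big: "\<forall>\<^sub>F n in sequentially. c + \<epsilon> + C \<le> sqrt (real n) * \<kappa>"
      by (simp add: filterlim_at_top)
    have ab: "c + 2 * \<epsilon> < c + 3 * \<epsilon>" using \<epsilon> by simp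
    have "Q.prob (A k) \<le> Q.prob {w \<in> space Q. \<forall>p\<in>F. c + 3 * \<epsilon> \<le> Y p w}"
    proof (rule Q.finite_measure_mono)
      show "A k \<subseteq> {w \<in> space Q. \<forall>p\<in>F. c + 3 * \<epsilon> \<le> Y p w}"
      proof
        fix w assume w: "w \<in> A k"
        have "c + 3 * \<epsilon> \<le> Y p w" if "p \<in> F" for p
          using w I_le[of w p] F(2) that by (auto simp: Ak)
        then show "w \<in> {w \<in> space Q. \<forall>p\<in>F. c + 3 * \<epsilon> \<le> Y p w}" using w by (auto simp: Ak)
      qed
      show "{w \<in> space Q. \<forall>p\<in>F. c + 3 * \<epsilon> \<le> Y p w} \<in> sets Q"
        using F Y(1) by (auto intro!: sets.sets_Collect_finite_All borel_measurable_le)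
    qed
    also have "\<dots> \<le> Q.expectation (\<lambda>w. \<Prod>p\<in>F. ramp (c + 2 * \<epsilon>) (c + 3 * \<epsilon>) (Y p w))"
      by (rule Q.prob_le_expectation_ramp) (use F ab Y in auto)
    finally have "Q.prob {w \<in> space Q. c < I w} - e / 2 < Q.expectation (\<lambda>w. \<Prod>p\<in>F. ramp (c + 2 * \<epsilon>) (c + 3 * \<epsilon>) (Y p w))"
      using k e by linarith
    from order_tendstoD(1)[OF products[OF F(1,2) ab] this] big eventually_gt_at_top[of 0]
    show ?thesis
    proof eventually_elim
      case (elim n)
      obtain B1 where B1: "B1 \<in> sets M" "prob B1 \<le> e / 4"
        "\<And>w p q. w \<in> space M - B1 \<Longrightarrow> p \<in> D \<Longrightarrow> q \<in> D \<Longrightarrow> dist p q \<le> \<delta> \<Longrightarrow> \<bar>G n p w - G n q w\<bar> \<le> \<epsilon>"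
        using \<delta>(2)[OF elim(3)] by blast
      obtain B2 where B2: "B2 \<in> sets M" "prob B2 \<le> e / 4" "\<And>w p. w \<in> space M - B2 \<Longrightarrow> p \<in> D \<Longrightarrow> \<bar>G n p w\<bar> \<le> C"
        using C[OF elim(3)] by blast
      let ?E = "{w \<in> space M. \<forall>p\<in>F. c + 2 * \<epsilon> < G n p w}"
      have "Q.prob {w \<in> space Q. c < I w} - e / 2 < expectation (\<lambda>w. \<Prod>p\<in>F. ramp (c + 2 * \<epsilon>) (c + 3 * \<epsilon>) (G n p w))"
        by (rule elim(1))
      also have "\<dots> \<le> prob ?E"
        by (rule expectation_ramp_le_prob) (use F ab GM in auto)
      also have "\<dots> \<le> prob ({w \<in> space M. c < Z n w} \<union> (B1 \<union> B2))"
      proof (rule finite_measure_mono)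
        show "?E \<subseteq> {w \<in> space M. c < Z n w} \<union> (B1 \<union> B2)"
        proof
          fix w assume wE: "w \<in> ?E"
          show "w \<in> {w \<in> space M. c < Z n w} \<union> (B1 \<union> B2)"
          proof (cases "w \<in> B1 \<union> B2")
            case False
            then have w: "w \<in> space M" "w \<in> space M - B1" "w \<in> space M - B2" using wE by auto
            have "c + \<epsilon> \<le> Z n w"
              unfolding Z_def penalized_infimum_def
            proof (rule cINF_greatest[OF D])
              fix p assume p: "p \<in> D"
              have \<phi>p: "0 \<le> sqrt (real n) * \<phi> p" using \<phi>(2)[OF p] by simp
              show "c + \<epsilon> \<le> G n p w + sqrt (real n) * \<phi> p"
              proof (cases "p \<in> far")
                case True
                have "sqrt (real n) * \<kappa> \<le> sqrt (real n) * \<phi> p" using \<kappa>(2)[OF True] by (intro mult_left_mono) auto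
                moreover have "\<bar>G n p w\<bar> \<le> C" by (rule B2(3)[OF w(3) p])
                ultimately show ?thesis using elim(2) by linarith
              next
                case False
                then obtain q where q: "q \<in> F" "dist p q \<le> \<delta>" using p by (auto simp: far_def dist_commute)
                have "\<bar>G n p w - G n q w\<bar> \<le> \<epsilon>" using q F SD by (intro B1(3)[OF w(2) p]) auto
                moreover have "c + 2 * \<epsilon> < G n q w" using wE q by auto
                ultimately show ?thesis using \<phi>p by linarith
              qed
            qed
            then show ?thesis using w \<epsilon> by auto
          qed auto
        qed
      qed (use B1 B2 in auto)
      also have "\<dots> \<le> prob {w \<in> space M. c < Z n w} + prob (B1 \<union> B2)"
        by (rule measure_Un_le) (use B1 B2 in auto)
      also have "\<dots> \<le> prob {w \<in> space M. c < Z n w} + e / 2"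
        using measure_Un_le[OF B1(1) B2(1)] B1(2) B2(2) by linarith
      finally show ?case by linarith
    qed
  qed

  have cdf_compl: "cdf (distr N borel V) c = 1 - measure N {w \<in> space N. c < V w}"
    if "prob_space N" "V \<in> borel_measurable N" for N :: "'b measure" and V c
  proof -
    interpret N: prob_space N by fact
    note [measurable] = that(2)
    have "cdf (distr N borel V) c = N.prob {w \<in> space N. V w \<le> c}"
      by (simp add: cdf_def measure_distr vimage_def Int_def conj_commute)
    also have "{w \<in> space N. V w \<le> c} = space N - {w \<in> space N. c < V w}" by auto
    also have "N.prob \<dots> = 1 - N.prob {w \<in> space N. c < V w}" by (rule N.prob_compl) measurable
    finally show ?thesis .
  qed
  show ?thesis
    unfolding weak_conv_m_def weak_conv_def Z_def[symmetric] I_def[symmetric, abs_def]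
  proof (intro allI impI)
    fix c assume cont: "isCont (cdf (distr Q borel I)) c"
    interpret RI: real_distribution "distr Q borel I" by (rule Q.real_distribution_distr) (rule Im)
    have "measure (distr Q borel I) {c} = 0" using cont by (simp add: RI.isCont_cdf)
    then have "Q.prob (I -` {c} \<inter> space Q) = 0" by (simp add: measure_distr)
    moreover have "{w \<in> space Q. c \<le> I w} = {w \<in> space Q. c < I w} \<union> (I -` {c} \<inter> space Q)" by auto
    moreover have "Q.prob ({w \<in> space Q. c < I w} \<union> (I -` {c} \<inter> space Q))
      \<le> Q.prob {w \<in> space Q. c < I w} + Q.prob (I -` {c} \<inter> space Q)"
      by (rule measure_Un_le) measurable
    ultimately have ge: "Q.prob {w \<in> space Q. c \<le> I w} \<le> Q.prob {w \<in> space Q. c < I w}" by simp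
    have "(\<lambda>n. prob {w \<in> space M. c < Z n w}) \<longlonglongrightarrow> Q.prob {w \<in> space Q. c < I w}"
    proof (rule tendstoI)
      fix e :: real assume "0 < e"
      then have "0 < e / 2" by simp
      from upper[OF this, of c] lower[OF this, of c]
      show "\<forall>\<^sub>F n in sequentially. dist (prob {w \<in> space M. c < Z n w}) (Q.prob {w \<in> space Q. c < I w}) < e"
      proof eventually_elim
        case (elim n)
        then have "prob {w \<in> space M. c < Z n w} \<le> Q.prob {w \<in> space Q. c < I w} + e / 2" using ge by linarith
        then show ?case using elim(2) \<open>0 < e\<close> unfolding dist_real_def by linarith
      qed
    qed
    then show "(\<lambda>n. cdf (distr M borel (Z n)) c) \<longlonglongrightarrow> cdf (distr Q borel I) c"
      unfolding cdf_compl[OF prob_space_axioms Zm] cdf_compl[OF Q Im] by (intro tendsto_intros)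
  qed
qed

end

section \<open>From extended real objectives to the penalized infimum\<close>

lemma (in prob_space) indep_vars_reindex:
  assumes inj: "inj_on h I" and indep: "indep_vars M' X (h ` I)"
  shows "indep_vars (\<lambda>i. M' (h i)) (\<lambda>i. X (h i)) I"
proof -
  have "indep_sets (\<lambda>i. F (h i)) I" if F: "indep_sets F (h ` I)" for F
    unfolding indep_sets_def
  proof (intro conjI ballI allI impI)
    show "F (h i) \<subseteq> events" if "i \<in> I" for i using F that by (auto simp: indep_sets_def)
    fix J A assume J: "J \<subseteq> I" "J \<noteq> {}" "finite J" and A: "A \<in> Pi J (\<lambda>i. F (h i))"
    have inv: "inv_into I h (h j) = j" if "j \<in> J" for j using inj J that by auto
    let ?A = "\<lambda>k. A (inv_into I h k)"
    have "?A \<in> Pi (h ` J) F" using A inv by auto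
    then have "prob (\<Inter>k\<in>h ` J. ?A k) = (\<Prod>k\<in>h ` J. prob (?A k))"
      using F[unfolded indep_sets_def, THEN conjunct2, rule_format, of "h ` J" ?A] J by blast
    then show "prob (\<Inter>j\<in>J. A j) = (\<Prod>j\<in>J. prob (A j))"
      using inv inj_on_subset[OF inj J(1)] by (simp add: prod.reindex)
  qed
  then show ?thesis using indep unfolding indep_vars_def2 by auto
qed

text \<open>
  The superlevel sets of \<open>u\<close> at real levels are sections of the hypograph.
\<close>

lemma borel_measurable_closed_hypograph:
  assumes "\<And>z. u z \<noteq> \<infinity>" "closed (hypograph u)"
  shows "u \<in> borel_measurable borel"
  unfolding borel_measurable_iff_Ici_ereal
proof
  fix a :: ereal
  show "u -` {a..} \<inter> space borel \<in> sets borel"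
  proof (cases a)
    case (real r)
    have "closed ((\<lambda>z. (z, r)) -` hypograph u)"
      by (intro closed_vimage assms continuous_intros)
    moreover have "(\<lambda>z. (z, r)) -` hypograph u = u -` {a..}" by (auto simp: hypograph_def real)
    ultimately show ?thesis by simp
  next
    case PInf
    then have "u -` {a..} = {}" using assms(1) by (auto simp: top_unique)
    then show ?thesis by simp
  next
    case MInf
    then have "u -` {a..} = UNIV" by auto
    then show ?thesis by simp
  qed
qed

lemma INF_ereal_compact:
  fixes g :: "'p::topological_space \<Rightarrow> real"
  assumes D: "compact D" "D \<noteq> {}" and g: "continuous_on D g"
  shows "(INF p\<in>D. ereal (g p)) = ereal (INF p\<in>D. g p)"
proof -
  obtain p where p: "p \<in> D" "\<And>q. q \<in> D \<Longrightarrow> g p \<le> g q"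
    using continuous_attains_inf[OF D g] by blast
  have "(INF p\<in>D. g p) = g p" "(INF p\<in>D. ereal (g p)) = ereal (g p)"
    using p by (auto intro!: cInf_eq_minimum)
  then show ?thesis by simp
qed

lemma INF_affine_compact:
  fixes g :: "'p::topological_space \<Rightarrow> real"
  assumes D: "compact D" "D \<noteq> {}" and g: "continuous_on D g" and "0 \<le> a"
  shows "a * ((INF p\<in>D. g p) - b) = (INF p\<in>D. a * (g p - b))"
proof -
  obtain p where p: "p \<in> D" "\<And>q. q \<in> D \<Longrightarrow> g p \<le> g q"
    using continuous_attains_inf[OF D g] by blast
  have "(INF p\<in>D. g p) = g p" "(INF p\<in>D. a * (g p - b)) = a * (g p - b)"
    using p \<open>0 \<le> a\<close> by (auto intro!: cInf_eq_minimum mult_left_mono)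
  then show ?thesis by simp
qed

lemma ereal_expectation_eq_integral:
  assumes g: "integrable M g" and eq: "AE w in M. f w = ereal (g w)"
  shows "ereal_expectation M f = ereal (\<integral>w. g w \<partial>M)"
proof -
  have "(\<integral>\<^sup>+w. e2ennreal (f w) \<partial>M) = (\<integral>\<^sup>+w. ennreal (g w) \<partial>M)"
    "(\<integral>\<^sup>+w. e2ennreal (- f w) \<partial>M) = (\<integral>\<^sup>+w. ennreal (- g w) \<partial>M)"
    using eq by (auto intro!: nn_integral_cong_AE)
  moreover have "(\<integral>\<^sup>+w. ennreal (g w) \<partial>M) \<noteq> \<infinity>" "(\<integral>\<^sup>+w. ennreal (- g w) \<partial>M) \<noteq> \<infinity>"
    using g by (simp_all add: real_integrable_def)
  ultimately show ?thesis
    unfolding ereal_expectation_def real_lebesgue_integral_def[OF g]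
    by (cases "\<integral>\<^sup>+w. ennreal (g w) \<partial>M"; cases "\<integral>\<^sup>+w. ennreal (- g w) \<partial>M") auto
qed

text \<open>
  A modification on a null set keeps measurability only with respect to the completion.
\<close>

lemma converges_in_distributionI_AE:
  assumes M: "prob_space M" and Z': "\<And>n. Z' n \<in> borel_measurable M" and eq: "AE w in M. \<forall>n. Z n w = Z' n w"
    and \<mu>: "real_distribution \<mu>" "weak_conv_m (\<lambda>n. distr M borel (Z' n)) \<mu>"
  shows "converges_in_distribution M Z \<mu>"
proof -
  have ae: "AE w in completion M. Z n w = Z' n w" for n
    using AE_completion[OF eq] by eventually_elim simp
  have Z'c: "Z' n \<in> borel_measurable (completion M)" for n by (rule measurable_completion[OF Z'])
  have Zc: "Z n \<in> borel_measurable (completion M)" for n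
  proof (rule measurableI)
    fix A :: "real set" assume "A \<in> sets borel"
    then have sets: "Z' n -` A \<inter> space (completion M) \<in> sets (completion M)" by (rule measurable_sets[OF Z'c])
    have "AE w in completion M. w \<in> Z' n -` A \<inter> space (completion M) \<longleftrightarrow> w \<in> Z n -` A \<inter> space (completion M)"
      using ae[of n] by eventually_elim auto
    from completion.in_sets_AE[OF this sets] show "Z n -` A \<inter> space (completion M) \<in> sets (completion M)" by simp
  qed simp
  have "distr (completion M) borel (Z n) = distr M borel (Z' n)" for n
  proof -
    have "distr (completion M) borel (Z n) = distr (completion M) borel (Z' n)"
      by (rule distr_cong_AE) (use ae Zc Z'c in auto)
    also have "\<dots> = distr M borel (Z' n)" by (rule distr_completion[OF Z'])
    finally show ?thesis .
  qed
  then show ?thesis using \<mu> Zc by (simp add: converges_in_distribution_def)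
qed

lemma (in lipschitz_sample) continuous_on_expectation: "continuous_on D (\<lambda>p. P.expectation (f p))"
proof -
  have "(P.expectation K)-lipschitz_on D (\<lambda>p. P.expectation (f p))"
  proof (rule lipschitz_onI)
    show "0 \<le> P.expectation K" by (rule integral_nonneg_AE) (simp add: K_nonneg)
    fix p q assume pq: "p \<in> D" "q \<in> D"
    have "\<bar>P.expectation (f p) - P.expectation (f q)\<bar> = \<bar>P.expectation (\<lambda>z. f p z - f q z)\<bar>"
      using pq by (simp add: f_integrable)
    also have "\<dots> \<le> P.expectation (\<lambda>z. \<bar>f p z - f q z\<bar>)" by (rule integral_abs_bound)
    also have "\<dots> \<le> P.expectation (\<lambda>z. K z * dist p q)"
      by (rule integral_mono) (use pq lip f_integrable K_integrable in auto)
    finally show "dist (P.expectation (f p)) (P.expectation (f q)) \<le> P.expectation K * dist p q"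
      by (simp add: dist_real_def)
  qed
  then show ?thesis by (rule lipschitz_on_continuous_on)
qed

lemma (in lipschitz_sample) continuous_on_sample_mean:
  assumes b: "continuous_on D b" and w: "w \<in> space M"
  shows "continuous_on D (\<lambda>p. (\<Sum>i<n. b p + f p (\<eta> i w)) / real n)"
proof -
  have "continuous_on D (\<lambda>p. f p (\<eta> i w))" for i
  proof -
    have "(K (\<eta> i w))-lipschitz_on D (\<lambda>p. f p (\<eta> i w))"
      using lip measurable_space[OF measurable_sample w] K_nonneg
      by (intro lipschitz_onI) (auto simp: dist_real_def)
    then show ?thesis by (rule lipschitz_on_continuous_on)
  qed
  then show ?thesis unfolding divide_inverse by (intro continuous_intros b)
qed

text \<open>
  The identity \<open>sqrt n * (sample mean - v) = G n p + sqrt n * (b p + E[f p] - v)\<close> is taken inside the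
  infimum. For \<open>n = 0\<close> both sides are 0, since division by 0 gives 0.
\<close>

lemma (in lipschitz_sample) scaled_sample_mean_infimum:
  assumes D: "D \<noteq> {}" and b: "continuous_on D b" and w: "w \<in> space M"
  shows "sqrt (real n) * ((INF p\<in>D. (\<Sum>i<n. b p + f p (\<eta> i w)) / real n) - v)
    = penalized_infimum (\<lambda>p. b p + P.expectation (f p) - v) n w"
proof (cases "n = 0")
  case True
  then show ?thesis using D by (simp add: penalized_infimum_def empirical_process_def)
next
  case False
  let ?h = "\<lambda>p. (\<Sum>i<n. b p + f p (\<eta> i w)) / real n"
  have eq: "sqrt (real n) * (?h p - v) = G n p w + sqrt (real n) * (b p + P.expectation (f p) - v)" for p
  proof -
    have "?h p = b p + (\<Sum>i<n. f p (\<eta> i w)) / n" using False by (simp add: sum.distrib add_divide_distrib)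
    moreover have "G n p w = sqrt n * ((\<Sum>i<n. f p (\<eta> i w)) / n - P.expectation (f p))"
    proof -
      have "G n p w = ((\<Sum>i<n. f p (\<eta> i w)) - n * P.expectation (f p)) / sqrt n"
        by (simp add: empirical_process_def sum_subtractf)
      also have "\<dots> = sqrt n / n * ((\<Sum>i<n. f p (\<eta> i w)) - n * P.expectation (f p))"
        by (subst sqrt_divide_self_eq) (simp_all add: divide_inverse mult.commute)
      also have "\<dots> = sqrt n * (((\<Sum>i<n. f p (\<eta> i w)) - n * P.expectation (f p)) / n)"
        by simp
      also have "((\<Sum>i<n. f p (\<eta> i w)) - n * P.expectation (f p)) / n = (\<Sum>i<n. f p (\<eta> i w)) / n - P.expectation (f p)"
        using False by (simp add: diff_divide_distrib)
      finally show ?thesis .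
    qed
    ultimately show ?thesis by (simp add: algebra_simps)
  qed
  show ?thesis
    unfolding penalized_infimum_def eq[symmetric]
    by (intro INF_affine_compact compact_D D continuous_on_sample_mean b w) auto
qed

section \<open>Convergence of optimal values\<close>

theorem proposition7:
  fixes u l :: "real \<Rightarrow> ereal"
    and X :: "'x::euclidean_space set"
    and T :: "real set"
    and M :: "'w measure"
    and \<xi> :: "'w \<Rightarrow> 'k::euclidean_space"
    and \<xi>s :: "nat \<Rightarrow> 'w \<Rightarrow> 'k"
    and c :: "'x \<Rightarrow> 'k \<Rightarrow> real"
    and K :: "'k \<Rightarrow> real"
    and vstar :: ereal
    and v :: "nat \<Rightarrow> 'w \<Rightarrow> ereal"
    and S :: "('x \<times> real) set"
    and Q :: "'q measure"
    and Y :: "'x \<times> real \<Rightarrow> 'q \<Rightarrow> real"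
  assumes u: "proper_closed_concave u" "mono u" "u 0 = 0" "1 \<in> concave_subdifferential u 0"
    and l: "l = (\<lambda>z. - u (- z))"
    and X: "compact X" "X \<noteq> {}"
    and T: "compact T" "is_interval T" "T \<noteq> {}"
    and M: "prob_space M"
    and \<xi>: "\<xi> \<in> borel_measurable M"
    and iid: "prob_space.indep_vars M (\<lambda>_. borel) \<xi>s {1..}"
             "\<And>i. i \<ge> 1 \<Longrightarrow> distr M borel (\<xi>s i) = distr M borel \<xi>"
    and c: "\<And>x. x \<in> X \<Longrightarrow> c x \<in> borel_measurable borel"
    and vstar: "vstar = optimal_value (oce_objective M l c \<xi>) (X \<times> T)"
    and S: "S = optimal_solutions (oce_objective M l c \<xi>) (X \<times> T)"
    and v: "v = (\<lambda>n w. optimal_value (saa_objective l c \<xi>s n w) (X \<times> T))"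
    and second_moment:
      "(SUP (x, t) \<in> X \<times> T. \<integral>\<^sup>+ w. e2ennreal ((l (c x (\<xi> w) - t))\<^sup>2) \<partial>M) < \<infinity>"
    and K: "K \<in> borel_measurable borel" "integrable M (\<lambda>w. (K (\<xi> w))\<^sup>2)"
    and lipschitz:
      "AE z in distr M borel \<xi>. \<forall>x1\<in>X. \<forall>x2\<in>X. \<forall>t1\<in>T. \<forall>t2\<in>T.
         \<bar>l (c x1 z - t1) - l (c x2 z - t2)\<bar> \<le> ereal (K z * norm ((x1, t1) - (x2, t2)))"
  shows
    "(prob_space Q \<and>
      centred_gaussian_in_C Q (X \<times> T)
        (\<lambda>(x, t) (x', t'). covariance M (\<lambda>w. real_of_ereal (l (c x (\<xi> w) - t)))
                                        (\<lambda>w. real_of_ereal (l (c x' (\<xi> w) - t')))) Y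
      \<longrightarrow>
      (\<lambda>w. INF p\<in>S. Y p w) \<in> borel_measurable Q \<and>
      converges_in_distribution M (\<lambda>n w. sqrt (real n) * real_of_ereal (v n w - vstar))
        (distr Q borel (\<lambda>w. INF p\<in>S. Y p w)))
     \<and>
     (\<forall>xstar tstar. S = {(xstar, tstar)} \<longrightarrow>
      converges_in_distribution M (\<lambda>n w. sqrt (real n) * real_of_ereal (v n w - vstar))
        (normal_law 0 (prob_space.variance M (\<lambda>w. real_of_ereal (l (c xstar (\<xi> w) - tstar))))))"
proof -
  interpret M: prob_space M by (rule M)
  define P where "P = distr M borel \<xi>"
  define D where "D = X \<times> T"
  define L where "L p z = l (c (fst p) z - snd p)" for p z
  \<comment> \<open>shifted, since the given observations are indexed from 1\<close>
  define \<eta> where "\<eta> i = \<xi>s (Suc i)" for i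
  have D: "compact D" "D \<noteq> {}" using X T by (auto simp: D_def intro: compact_Times)

  have "u \<in> borel_measurable borel"
    using u(1) by (intro borel_measurable_closed_hypograph) (auto simp: proper_closed_concave_def)
  then have l_meas [measurable]: "l \<in> borel_measurable borel" unfolding l by measurable
  have L_meas [measurable]: "L p \<in> borel_measurable borel" if "p \<in> D" for p
  proof -
    have [measurable]: "c (fst p) \<in> borel_measurable borel" using that c by (auto simp: D_def)
    show ?thesis unfolding L_def[abs_def] by measurable
  qed

  obtain N where N: "N \<in> null_sets P" and lip_N: "\<And>z. z \<notin> N \<Longrightarrow> \<forall>x1\<in>X. \<forall>x2\<in>X. \<forall>t1\<in>T. \<forall>t2\<in>T.
      \<bar>l (c x1 z - t1) - l (c x2 z - t2)\<bar> \<le> ereal (K z * norm ((x1, t1) - (x2, t2)))"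
    using AE_E3[OF lipschitz] unfolding P_def by (metis DiffI UNIV_I space_borel space_distr)
  have [measurable]: "N \<in> sets borel" using N by (auto simp: P_def null_sets_def)
  have L_lip: "\<bar>L p z - L q z\<bar> \<le> ereal (K z * dist p q)" if "z \<notin> N" "p \<in> D" "q \<in> D" for p q z
    using lip_N[OF that(1), rule_format, of "fst p" "fst q" "snd p" "snd q"] that(2,3)
    by (simp add: L_def D_def dist_norm mem_Times_iff del: diff_Pair)
  \<comment> \<open>\<open>\<bar>\<infinity> - \<infinity>\<bar> = \<infinity>\<close>, so the Lipschitz bound with equal arguments forces finite values\<close>
  have L_finite: "L p z = ereal (real_of_ereal (L p z))" if "z \<notin> N" "p \<in> D" for p z
    using L_lip[OF that that(2)] by (cases "L p z") auto

  \<comment> \<open>off the null set \<open>N\<close> the values are finite and the bound holds; on \<open>N\<close> values and bound are reset to 0\<close>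
  define f where "f p z = (if z \<in> N then 0 else real_of_ereal (L p z))" for p z
  define K0 where "K0 z = (if z \<in> N then 0 else \<bar>K z\<bar>)" for z
  have L_f: "L p z = ereal (f p z)" if "z \<notin> N" "p \<in> D" for p z
    using L_finite[OF that] that by (simp add: f_def)
  have f_meas [measurable]: "f p \<in> borel_measurable borel" if "p \<in> D" for p
    using that unfolding f_def[abs_def] by measurable
  have K0_meas [measurable]: "K0 \<in> borel_measurable borel"
    using K(1) unfolding K0_def[abs_def] by measurable
  have \<xi>_ae: "AE w in M. \<xi> w \<notin> N"
    using AE_not_in[OF N] unfolding P_def by (rule AE_distrD[OF \<xi>])
  have \<eta>_meas: "\<eta> i \<in> borel_measurable M" for i
    using iid(1) by (auto simp: \<eta>_def M.indep_vars_def2)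
  have \<eta>_law: "distr M borel (\<eta> i) = P" for i unfolding \<eta>_def P_def by (rule iid(2)) simp
  have \<eta>_ae: "AE w in M. \<forall>i. \<eta> i w \<notin> N"
  proof (subst AE_all_countable, intro allI)
    fix i
    have "AE z in distr M borel (\<eta> i). z \<notin> N" unfolding \<eta>_law by (rule AE_not_in[OF N])
    then show "AE w in M. \<eta> i w \<notin> N" by (rule AE_distrD[OF \<eta>_meas])
  qed

  interpret S: lipschitz_sample M P \<eta> D f K0
  proof unfold_locales
    have setsP: "sets P = sets borel" by (simp add: P_def)
    have "Suc ` UNIV = {1..}" by (auto simp: image_iff Suc_le_eq) (metis Suc_pred)
    then have "M.indep_vars (\<lambda>_. borel) \<eta> UNIV"
      using M.indep_vars_reindex[of Suc UNIV "\<lambda>_. borel" \<xi>s] iid(1) by (simp add: \<eta>_def[abs_def])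
    then show "M.indep_vars (\<lambda>_. P) \<eta> UNIV"
      by (simp add: M.indep_vars_def2 setsP measurable_cong_sets[OF refl setsP])
    show "distr M P (\<eta> i) = P" for i
      using \<eta>_law[of i] distr_cong[OF refl setsP, of M "\<eta> i" "\<eta> i"] by simp
    show "compact D" by (rule D)
    show "f p \<in> borel_measurable P" if "p \<in> D" for p using f_meas[OF that] by (simp add: P_def)
    show "integrable P (\<lambda>z. (f p z)\<^sup>2)" if p: "p \<in> D" for p
    proof -
      have "(\<integral>\<^sup>+w. ennreal ((f p (\<xi> w))\<^sup>2) \<partial>M) = (\<integral>\<^sup>+w. e2ennreal ((L p (\<xi> w))\<^sup>2) \<partial>M)"
        using \<xi>_ae L_f[OF _ p] by (intro nn_integral_cong_AE) (auto simp: power2_eq_square)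
      also have "\<dots> \<le> (SUP (x, t) \<in> X \<times> T. \<integral>\<^sup>+ w. e2ennreal ((l (c x (\<xi> w) - t))\<^sup>2) \<partial>M)"
        using p by (intro SUP_upper2[of p]) (auto simp: D_def L_def case_prod_beta)
      also have "\<dots> < \<infinity>" by (rule second_moment)
      finally have "integrable M (\<lambda>w. (f p (\<xi> w))\<^sup>2)"
        using \<xi> f_meas[OF p] by (intro integrableI_bounded) auto
      then show ?thesis using \<xi> f_meas[OF p] unfolding P_def by (subst integrable_distr_eq) auto
    qed
    show "K0 \<in> borel_measurable P" using K0_meas by (simp add: P_def)
    show "0 \<le> K0 z" for z by (simp add: K0_def)
    show "integrable P (\<lambda>z. (K0 z)\<^sup>2)"
    proof -
      have "integrable M (\<lambda>w. (K0 (\<xi> w))\<^sup>2)"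
      proof (rule Bochner_Integration.integrable_bound[OF K(2)])
        show "(\<lambda>w. (K0 (\<xi> w))\<^sup>2) \<in> borel_measurable M"
          by (rule borel_measurable_power[OF measurable_compose[OF \<xi> K0_meas]])
      qed (simp add: K0_def)
      then show ?thesis using \<xi> K0_meas unfolding P_def by (subst integrable_distr_eq) auto
    qed
    show "\<bar>f p z - f q z\<bar> \<le> K0 z * dist p q" if "p \<in> D" "q \<in> D" for p q z
    proof (cases "z \<in> N")
      case False
      have "\<bar>f p z - f q z\<bar> \<le> K z * dist p q"
        using L_lip[OF False that] L_f[OF False that(1)] L_f[OF False that(2)] by simp
      also have "\<dots> \<le> K0 z * dist p q" using False by (intro mult_right_mono) (auto simp: K0_def)
      finally show ?thesis .
    qed (simp add: f_def K0_def)
  qed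

  have expectation_f: "(\<integral>w. h (\<xi> w) \<partial>M) = S.P.expectation h" if "h \<in> borel_measurable borel" for h :: "'k \<Rightarrow> real"
    unfolding P_def using \<xi> that by (simp add: integral_distr)
  have f_\<xi>_ae: "AE w in M. l (c (fst p) (\<xi> w) - snd p) = ereal (f p (\<xi> w))" if "p \<in> D" for p
    using \<xi>_ae by eventually_elim (use L_f that in \<open>simp add: L_def\<close>)
  have objective: "oce_objective M l c \<xi> p = ereal (snd p + S.P.expectation (f p))" if p: "p \<in> D" for p
  proof -
    have "integrable M (\<lambda>w. f p (\<xi> w))"
      using S.f_integrable[OF p] \<xi> f_meas[OF p] unfolding P_def by (subst (asm) integrable_distr_eq) auto
    from ereal_expectation_eq_integral[OF this f_\<xi>_ae[OF p]] show ?thesis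
      using expectation_f[OF f_meas[OF p]] by (simp add: oce_objective_def case_prod_beta)
  qed
  define v0 where "v0 = (INF p\<in>D. snd p + S.P.expectation (f p))"
  define \<phi> where "\<phi> p = snd p + S.P.expectation (f p) - v0" for p
  have snd_cont: "continuous_on D snd" by (intro continuous_intros)
  have g_cont: "continuous_on D (\<lambda>p. snd p + S.P.expectation (f p))"
    by (intro continuous_intros snd_cont S.continuous_on_expectation)
  have vstar_eq: "vstar = ereal v0"
    unfolding vstar optimal_value_def D_def[symmetric] v0_def INF_ereal_compact[OF D g_cont, symmetric]
    by (rule INF_cong) (auto simp: objective)
  have S_eq: "S = {p \<in> D. \<phi> p = 0}"
  proof -
    have "optimal_value (oce_objective M l c \<xi>) D = ereal v0" using vstar vstar_eq by (simp add: D_def)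
    then show ?thesis unfolding S optimal_solutions_def D_def[symmetric] by (auto simp: objective \<phi>_def)
  qed
  have \<phi>_cont: "continuous_on D \<phi>" unfolding \<phi>_def[abs_def] by (intro continuous_intros g_cont)
  have \<phi>_nonneg: "0 \<le> \<phi> p" if "p \<in> D" for p
    using cINF_lower[OF bdd_below_image_compact[OF D(1) g_cont] that] by (simp add: \<phi>_def v0_def)
  have S_ne: "S \<noteq> {}"
  proof -
    obtain p where p: "p \<in> D" "\<And>q. q \<in> D \<Longrightarrow> snd p + S.P.expectation (f p) \<le> snd q + S.P.expectation (f q)"
      using continuous_attains_inf[OF D g_cont] by blast
    then have "v0 = snd p + S.P.expectation (f p)" unfolding v0_def by (intro cInf_eq_minimum) auto
    then have "p \<in> S" using p(1) unfolding S_eq \<phi>_def by simp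
    then show ?thesis by blast
  qed
  have SD: "S \<subseteq> D" by (auto simp: S_eq)
  have cS: "compact S"
  proof -
    have "closed (D \<inter> \<phi> -` {0})"
      by (rule continuous_closed_preimage[OF \<phi>_cont compact_imp_closed[OF D(1)] closed_singleton])
    moreover have "D \<inter> \<phi> -` {0} = S" by (auto simp: S_eq)
    ultimately show ?thesis using compact_Int_closed[OF D(1), of S] SD by (simp add: Int_absorb1)
  qed

  let ?Z = "\<lambda>n w. sqrt (real n) * real_of_ereal (v n w - vstar)"
  have Z_eq: "AE w in M. \<forall>n. ?Z n w = S.penalized_infimum \<phi> n w"
    using \<eta>_ae AE_space
  proof eventually_elim
    case (elim w)
    show ?case
    proof
      fix n
      have saa: "saa_objective l c \<xi>s n w p = ereal ((\<Sum>i<n. snd p + f p (\<eta> i w)) / real n)" if p: "p \<in> D" for p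
      proof -
        have "l (c (fst p) (\<xi>s (Suc i) w) - snd p) = ereal (f p (\<eta> i w))" for i
          using L_f[OF _ p, of "\<eta> i w"] elim by (simp add: L_def \<eta>_def)
        then show ?thesis
          by (simp add: saa_objective_def case_prod_beta sum.atLeast1_atMost_eq)
      qed
      have "v n w = ereal (INF p\<in>D. (\<Sum>i<n. snd p + f p (\<eta> i w)) / real n)"
        unfolding v optimal_value_def D_def[symmetric]
          INF_ereal_compact[OF D S.continuous_on_sample_mean[OF snd_cont elim(2)], symmetric]
        by (rule INF_cong) (auto simp: saa)
      then show "?Z n w = S.penalized_infimum \<phi> n w"
        unfolding \<phi>_def[abs_def] using S.scaled_sample_mean_infimum[OF D(2) snd_cont elim(2), of n v0]
        by (simp add: vstar_eq)
    qed
  qed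
  note converges = converges_in_distributionI_AE[OF M S.borel_measurable_penalized_infimum[OF D(2) \<phi>_cont] Z_eq]
  have cov: "covariance M (\<lambda>w. real_of_ereal (l (c (fst p) (\<xi> w) - snd p))) (\<lambda>w. real_of_ereal (l (c (fst q) (\<xi> w) - snd q)))
    = covariance P (f p) (f q)" if pq: "p \<in> D" "q \<in> D" for p q
  proof -
    have [measurable]: "c (fst r) \<in> borel_measurable borel" if "r \<in> D" for r using that c by (auto simp: D_def)
    note [measurable] = \<xi>
    have mean: "(\<integral>w. real_of_ereal (l (c (fst r) (\<xi> w) - snd r)) \<partial>M) = S.P.expectation (f r)" if r: "r \<in> D" for r
    proof -
      have "(\<integral>w. real_of_ereal (l (c (fst r) (\<xi> w) - snd r)) \<partial>M) = (\<integral>w. f r (\<xi> w) \<partial>M)"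
        by (rule integral_cong_AE) (use r f_\<xi>_ae[OF r] in auto)
      then show ?thesis using expectation_f[OF f_meas[OF r]] by simp
    qed
    have "covariance M (\<lambda>w. real_of_ereal (l (c (fst p) (\<xi> w) - snd p))) (\<lambda>w. real_of_ereal (l (c (fst q) (\<xi> w) - snd q)))
      = (\<integral>w. (f p (\<xi> w) - S.P.expectation (f p)) * (f q (\<xi> w) - S.P.expectation (f q)) \<partial>M)"
      unfolding covariance_def mean[OF pq(1)] mean[OF pq(2)]
      by (rule integral_cong_AE) (use pq f_\<xi>_ae[OF pq(1)] f_\<xi>_ae[OF pq(2)] in auto)
    also have "\<dots> = covariance P (f p) (f q)"
      unfolding covariance_def by (rule expectation_f) (use pq in measurable)
    finally show ?thesis .
  qed

  show ?thesis
  proof (intro conjI impI allI)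
    let ?k = "\<lambda>(x, t) (x', t'). covariance M (\<lambda>w. real_of_ereal (l (c x (\<xi> w) - t)))
                                        (\<lambda>w. real_of_ereal (l (c x' (\<xi> w) - t')))"
    assume "prob_space Q \<and> centred_gaussian_in_C Q (X \<times> T) ?k Y"
    then have Q: "prob_space Q" and Y: "centred_gaussian_in_C Q D ?k Y" by (auto simp: D_def)
    have Y_meas: "Y p \<in> borel_measurable Q" if "p \<in> S" for p
      using Y that SD by (auto simp: centred_gaussian_in_C_def)
    have Y_cont: "continuous_on S (\<lambda>p. Y p w)" if "w \<in> space Q" for w
      using Y that by (auto simp: centred_gaussian_in_C_def intro: continuous_on_subset[OF _ SD])
    show inf_meas: "(\<lambda>w. INF p\<in>S. Y p w) \<in> borel_measurable Q"
      by (rule borel_measurable_INF_compact[OF cS S_ne Y_meas Y_cont])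
    have fidi: "(\<lambda>n. M.expectation (\<lambda>w. iexp (\<Sum>p\<in>F. a p * S.G n p w))) \<longlonglongrightarrow> (\<integral>w. iexp (\<Sum>p\<in>F. a p * Y p w) \<partial>Q)"
      if F: "finite F" "F \<subseteq> S" for F a
    proof -
      have FD: "F \<subseteq> D" using F SD by auto
      have "(\<Sum>p\<in>F. \<Sum>q\<in>F. a p * a q * ?k p q) = (\<Sum>p\<in>F. \<Sum>q\<in>F. a p * a q * covariance P (f p) (f q))"
      proof (intro sum.cong refl)
        fix p q assume "p \<in> F" "q \<in> F"
        then have "p \<in> D" "q \<in> D" using FD by auto
        from cov[OF this] show "a p * a q * ?k p q = a p * a q * covariance P (f p) (f q)"
          by (simp add: case_prod_beta)
      qed
      then show ?thesis
        using S.char_linear_combination_G[OF F(1) FD, of a]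
        unfolding char_linear_combination_centred_gaussian[OF Q Y F(1) FD] by simp
    qed
    show "converges_in_distribution M ?Z (distr Q borel (\<lambda>w. INF p\<in>S. Y p w))"
    proof (rule converges)
      show "real_distribution (distr Q borel (\<lambda>w. INF p\<in>S. Y p w))"
        by (rule prob_space.real_distribution_distr[OF Q inf_meas])
      show "weak_conv_m (\<lambda>n. distr M borel (S.penalized_infimum \<phi> n)) (distr Q borel (\<lambda>w. INF p\<in>S. Y p w))"
        by (rule S.penalized_infimum_converges[OF \<phi>_cont \<phi>_nonneg S_eq S_ne Q Y_meas Y_cont fidi])
    qed
  next
    fix xstar tstar assume single: "S = {(xstar, tstar)}"
    define p where "p = (xstar, tstar)"
    have p: "p \<in> D" "S = {p}" using single SD by (auto simp: p_def)
    define s2 where "s2 = M.variance (\<lambda>w. real_of_ereal (l (c xstar (\<xi> w) - tstar)))"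
    \<comment> \<open>the variance at the minimizer is the covariance of \<open>f p\<close> with itself\<close>
    have s2: "0 \<le> s2" "covariance P (f p) (f p) = s2"
      using cov[OF p(1) p(1)] by (auto simp: s2_def p_def covariance_def power2_eq_square intro!: integral_nonneg_AE)
    interpret law: real_distribution "normal_law 0 s2" by (rule real_distribution_normal_law[OF s2(1)])
    have fidi: "(\<lambda>n. M.expectation (\<lambda>w. iexp (\<Sum>p\<in>F. a p * S.G n p w))) \<longlonglongrightarrow> (\<integral>x. iexp (\<Sum>p\<in>F. a p * x) \<partial>normal_law 0 s2)"
      if F: "finite F" "F \<subseteq> S" for F and a :: "'x \<times> real \<Rightarrow> real"
    proof -
      have FD: "F \<subseteq> D" using F SD by auto
      consider "F = {}" | "F = {p}" using F p by auto
      then have "(\<integral>x. iexp (\<Sum>p\<in>F. a p * x) \<partial>normal_law 0 s2)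
        = exp (- (\<Sum>p\<in>F. \<Sum>q\<in>F. a p * a q * covariance P (f p) (f q)) / 2)"
      proof cases
        case 1
        then show ?thesis using law.prob_space by simp
      next
        case 2
        then show ?thesis using char_normal_law[OF s2(1), of "a p"] s2(2) by (simp add: power2_eq_square)
      qed
      then show ?thesis using S.char_linear_combination_G[OF F(1) FD, of a] by simp
    qed
    \<comment> \<open>the limit process on the singleton \<open>S\<close> is the identity on the probability space \<open>normal_law 0 s2\<close>\<close>
    have "weak_conv_m (\<lambda>n. distr M borel (S.penalized_infimum \<phi> n)) (distr (normal_law 0 s2) borel (\<lambda>x. INF p\<in>S. x))"
      by (rule S.penalized_infimum_converges[OF \<phi>_cont \<phi>_nonneg S_eq S_ne law.prob_space_axioms _ _ fidi])
        (auto intro!: continuous_intros)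
    moreover have "distr (normal_law 0 s2) borel (\<lambda>x. INF p\<in>S. x) = normal_law 0 s2"
      using S_ne by (simp add: distr_id2)
    ultimately have "converges_in_distribution M ?Z (normal_law 0 s2)"
      by (intro converges law.real_distribution_axioms) simp
    then show "converges_in_distribution M ?Z
        (normal_law 0 (M.variance (\<lambda>w. real_of_ereal (l (c xstar (\<xi> w) - tstar)))))"
      by (simp add: s2_def)
  qed
qed

end
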